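(* Let $A$ and $B$ be $\sigma$-unital $\mathbb{Z}_2$-graded $C^*$-algebras, and let $(\pi,E,\mathcal{D})$ be an unbounded $A$-$B$-cycle with spectral symmetry $S$. Then $(\pi,E,\mathcal{D}+S)$ is a spectrally degenerate unbounded $A$-$B$-cycle.
   Context: Conventions: $[a,b]$ denotes the graded commutator. Hilbert modules are $\mathbb{Z}_2$-graded and countably generated; $\mathrm{End}_B^*(E)$ and $\mathrm{End}_B^0(E)$ denote the adjointable and the compact operators on $E$; $\overline{W}$ is the operator-norm closure of $W\subset\mathrm{End}_B^*(E)$. For a regular self-adjoint operator $\mathcal{D}$ on $E$, let $\mathrm{Lip}(\mathcal{D})$ be the set of $T\in\mathrm{End}_B^*(E)$ with $T(\mathrm{Dom}\,\mathcal{D})\subset\mathrm{Dom}\,\mathcal{D}$ and such that $[\mathcal{D},T]$ is (extends to) an element of $\mathrm{End}_B^*(E)$, and let $\mathrm{Lip}^0(\mathcal{D}):=\{T\in\mathrm{Lip}(\mathcal{D}) : T(1+\mathcal{D}^2)^{-1/2},\,T^*(1+\mathcal{D}^2)^{-1/2}\in\mathrm{End}_B^0(E)\}$. An unbounded $A$-$B$-cycle $(\pi,E,\mathcal{D})$ consists of a $\mathbb{Z}_2$-graded countably generated Hilbert $B$-module $E$, a $\mathbb{Z}_2$-graded $*$-homomorphism $\pi\colon A\to\mathrm{End}_B^*(E)$, and an odd regular self-adjoint operator $\mathcal{D}$ on $E$ such that $\pi(A)\subset\overline{\mathrm{Lip}^0(\mathcal{D})}$. A spectral symmetry of $(\pi,E,\mathcal{D})$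 is an odd self-adjoint unitary $S$ on $E$ for which there is a subset $W\subset\mathrm{Lip}^0(\mathcal{D})$ such that $\pi(A)\subset\overline{W}$, $[S,w]=0$ for all $w\in W$, $S\colon\mathrm{Dom}\,\mathcal{D}\to\mathrm{Dom}\,\mathcal{D}$, $\mathcal{D}S-S\mathcal{D}=0$, and $S\mathcal{D}$ is positive. A cycle $(\pi,E,\mathcal{D})$ is spectrally degenerate if $\mathcal{D}$ is invertible (i.e. there is $\mathcal{D}^{-1}\in\mathrm{End}_B^*(E)$ with $\mathcal{D}\mathcal{D}^{-1}=\mathcal{D}^{-1}\mathcal{D}=1$) and there is a subset $W\subset\mathrm{Lip}^0(\mathcal{D})$ with $\pi(A)\subset\overline{W}$ and $[\mathrm{sgn}(\mathcal{D}),w]=0$ for all $w\in W$, where $\mathrm{sgn}(\mathcal{D})=\mathcal{D}|\mathcal{D}|^{-1}$. *)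

theory Defs
  imports "HOL-Analysis.Analysis"
begin

section \<open>Graded C*-algebras\<close>

class complex_vector = real_vector +
  fixes scaleC :: "complex \<Rightarrow> 'a \<Rightarrow> 'a" (infixr "*\<^sub>C" 75)
  assumes scaleC_add_right: "c *\<^sub>C (x + y) = c *\<^sub>C x + c *\<^sub>C y"
    and scaleC_add_left: "(c + d) *\<^sub>C x = c *\<^sub>C x + d *\<^sub>C x"
    and scaleC_scaleC: "c *\<^sub>C (d *\<^sub>C x) = (c * d) *\<^sub>C x"
    and scaleC_of_real: "complex_of_real r *\<^sub>C x = r *\<^sub>R x"

text \<open>Not necessarily unital; the zero algebra is allowed.\<close>

class cstar_algebra = complex_vector + real_normed_algebra + banach +
  fixes star :: "'a \<Rightarrow> 'a"
  assumes mult_scaleC_left: "(c *\<^sub>C x) * y = c *\<^sub>C (x * y)"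
    and mult_scaleC_right: "x * (c *\<^sub>C y) = c *\<^sub>C (x * y)"
    and norm_scaleC: "norm (c *\<^sub>C x) = cmod c * norm x"
    and star_add: "star (x + y) = star x + star y"
    and star_scaleC: "star (c *\<^sub>C x) = cnj c *\<^sub>C star x"
    and star_mult: "star (x * y) = star y * star x"
    and star_star: "star (star x) = x"
    and cstar_identity: "norm (star x * x) = (norm x)\<^sup>2"

text \<open>A grading is given by its grading automorphism, which is \<open>1\<close> on the even and
  \<open>-1\<close> on the odd part.\<close>

class z2_graded_cstar_algebra = cstar_algebra +
  fixes grading :: "'a \<Rightarrow> 'a"
  assumes grading_add: "grading (x + y) = grading x + grading y"
    and grading_scaleC: "grading (c *\<^sub>C x) = c *\<^sub>C grading x"
    and grading_mult: "grading (x * y) = grading x * grading y"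
    and grading_star: "grading (star x) = star (grading x)"
    and grading_grading: "grading (grading x) = x"

definition pos_elem :: "'a::cstar_algebra \<Rightarrow> bool" where
  "pos_elem a \<longleftrightarrow> (\<exists>c. a = star c * c)"

text \<open>Existence of a countable (sequential) approximate unit.\<close>

definition sigma_unital :: "'a::cstar_algebra itself \<Rightarrow> bool" where
  "sigma_unital _ \<longleftrightarrow>
     (\<exists>u :: nat \<Rightarrow> 'a.
        (\<forall>n. pos_elem (u n) \<and> norm (u n) \<le> 1 \<and> pos_elem (u (Suc n) - u n)) \<and>
        (\<forall>a. (\<lambda>n. u n * a) \<longlonglongrightarrow> a \<and> (\<lambda>n. a * u n) \<longlonglongrightarrow> a))"


section \<open>Graded Hilbert modules\<close>

record ('e, 'b) hmod =
  act :: "'e \<Rightarrow> 'b \<Rightarrow> 'e"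
  inn :: "'e \<Rightarrow> 'e \<Rightarrow> 'b"
  mgrading :: "'e \<Rightarrow> 'e"

text \<open>The module norm is the norm of the type \<open>'e\<close> (axiom \<open>norm_inn\<close>); completeness is
  the class \<open>banach\<close>.\<close>

locale graded_hilbert_module =
  fixes E :: "('e::{complex_vector, banach}, 'b::z2_graded_cstar_algebra) hmod"
  assumes act_add_left: "act E (x + y) b = act E x b + act E y b"
    and act_add_right: "act E x (b + c) = act E x b + act E x c"
    and act_mult: "act E x (b * c) = act E (act E x b) c"
    and act_scaleC_left: "act E (k *\<^sub>C x) b = k *\<^sub>C act E x b"
    and act_scaleC_right: "act E x (k *\<^sub>C b) = k *\<^sub>C act E x b"
    and inn_add_right: "inn E x (y + z) = inn E x y + inn E x z"
    and inn_scaleC_right: "inn E x (k *\<^sub>C y) = k *\<^sub>C inn E x y"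
    and inn_act_right: "inn E x (act E y b) = inn E x y * b"
    and inn_star: "star (inn E x y) = inn E y x"
    and inn_pos: "pos_elem (inn E x x)"
    and inn_definite: "inn E x x = 0 \<Longrightarrow> x = 0"
    and norm_inn: "norm x = sqrt (norm (inn E x x))"
    and mgrading_add: "mgrading E (x + y) = mgrading E x + mgrading E y"
    and mgrading_scaleC: "mgrading E (k *\<^sub>C x) = k *\<^sub>C mgrading E x"
    and mgrading_act: "mgrading E (act E x b) = act E (mgrading E x) (grading b)"
    and mgrading_inn: "inn E (mgrading E x) (mgrading E y) = grading (inn E x y)"
    and mgrading_mgrading: "mgrading E (mgrading E x) = x"

definition submodule ::
    "('e::{complex_vector, banach}, 'b::z2_graded_cstar_algebra) hmod \<Rightarrow> 'e set \<Rightarrow> bool" where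
  "submodule E M \<longleftrightarrow>
     0 \<in> M \<and> (\<forall>x\<in>M. \<forall>y\<in>M. x + y \<in> M) \<and> (\<forall>k. \<forall>x\<in>M. k *\<^sub>C x \<in> M) \<and> (\<forall>b. \<forall>x\<in>M. act E x b \<in> M)"

definition countably_generated ::
    "('e::{complex_vector, banach}, 'b::z2_graded_cstar_algebra) hmod \<Rightarrow> bool" where
  "countably_generated E \<longleftrightarrow>
     (\<exists>X. countable X \<and> (\<forall>M. submodule E M \<and> closed M \<and> X \<subseteq> M \<longrightarrow> M = UNIV))"


section \<open>Bounded operators\<close>

text \<open>Everywhere defined operators live in \<open>'e \<Rightarrow>\<^sub>L 'e\<close>, whose norm is the operator norm, so
  that \<open>closure\<close> of a set of such operators is the operator-norm closure. An operator with
  an adjoint is automatically complex linear and \<open>B\<close>-linear.\<close>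

definition is_adjoint ::
    "('e::{complex_vector, banach}, 'b::z2_graded_cstar_algebra) hmod
      \<Rightarrow> ('e \<Rightarrow>\<^sub>L 'e) \<Rightarrow> ('e \<Rightarrow>\<^sub>L 'e) \<Rightarrow> bool" where
  "is_adjoint E T T' \<longleftrightarrow> (\<forall>x y. inn E (T x) y = inn E x (T' y))"

definition End_adj ::
    "('e::{complex_vector, banach}, 'b::z2_graded_cstar_algebra) hmod \<Rightarrow> ('e \<Rightarrow>\<^sub>L 'e) set" where
  "End_adj E = {T. \<exists>T'. is_adjoint E T T'}"

definition adj ::
    "('e::{complex_vector, banach}, 'b::z2_graded_cstar_algebra) hmod
      \<Rightarrow> ('e \<Rightarrow>\<^sub>L 'e) \<Rightarrow> ('e \<Rightarrow>\<^sub>L 'e)" where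
  "adj E T = (THE T'. is_adjoint E T T')"

text \<open>Norm closure of the span of the operators \<open>z \<mapsto> x\<langle>y,z\<rangle>\<close>. The real span is already
  the complex one, since a complex multiple can be absorbed into \<open>x\<close>.\<close>

definition End_cpt ::
    "('e::{complex_vector, banach}, 'b::z2_graded_cstar_algebra) hmod \<Rightarrow> ('e \<Rightarrow>\<^sub>L 'e) set" where
  "End_cpt E = closure (span {T. \<exists>x y. \<forall>z. blinfun_apply T z = act E x (inn E y z)})"

text \<open>The homogeneous component of degree \<open>i \<in> {0, 1}\<close> of an operator, and the graded
  commutator \<open>ab - (-1)\<^bsup>|a||b|\<^esup> ba\<close> extended bilinearly from homogeneous operators. They are
  formed pointwise, so that \<open>a\<close> may be an unbounded operator; the value at \<open>x\<close> is then
  meaningful if \<open>x\<close> is in its domain and the domain is invariant under the grading and \<open>b\<close>.\<close>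

definition hcomp ::
    "('e::{complex_vector, banach}, 'b::z2_graded_cstar_algebra) hmod
      \<Rightarrow> nat \<Rightarrow> ('e \<Rightarrow> 'e) \<Rightarrow> ('e \<Rightarrow> 'e)" where
  "hcomp E i a x = (1/2) *\<^sub>R (a x + (-1)^i *\<^sub>R mgrading E (a (mgrading E x)))"

definition gcomm ::
    "('e::{complex_vector, banach}, 'b::z2_graded_cstar_algebra) hmod
      \<Rightarrow> ('e \<Rightarrow> 'e) \<Rightarrow> ('e \<Rightarrow> 'e) \<Rightarrow> ('e \<Rightarrow> 'e)" where
  "gcomm E a b x =
     (\<Sum>i\<in>{0,1}. \<Sum>j\<in>{0,1}.
        hcomp E i a (hcomp E j b x) - (-1)^(i * j) *\<^sub>R hcomp E j b (hcomp E i a x))"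


section \<open>Unbounded operators\<close>

text \<open>An operator is a partial map \<open>D :: 'e \<rightharpoonup> 'e\<close> with domain \<open>dom D\<close> and graph
  \<open>Map.graph D\<close>; the composition \<open>\<circ>\<^sub>m\<close> of partial maps is the one of unbounded operators.\<close>

definition total_op :: "('e::real_normed_vector \<Rightarrow>\<^sub>L 'e) \<Rightarrow> ('e \<rightharpoonup> 'e)" where
  "total_op T = (\<lambda>x. Some (T x))"

definition plus_op :: "('e::real_normed_vector \<rightharpoonup> 'e) \<Rightarrow> ('e \<Rightarrow>\<^sub>L 'e) \<Rightarrow> ('e \<rightharpoonup> 'e)" where
  "plus_op D T = (\<lambda>x. map_option (\<lambda>y. y + T x) (D x))"

definition linear_op ::
    "('e::{complex_vector, banach}, 'b::z2_graded_cstar_algebra) hmod \<Rightarrow> ('e \<rightharpoonup> 'e) \<Rightarrow> bool" where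
  "linear_op E D \<longleftrightarrow>
     submodule E (dom D) \<and>
     (\<forall>x\<in>dom D. \<forall>y\<in>dom D. the (D (x + y)) = the (D x) + the (D y)) \<and>
     (\<forall>k. \<forall>x\<in>dom D. the (D (k *\<^sub>C x)) = k *\<^sub>C the (D x)) \<and>
     (\<forall>b. \<forall>x\<in>dom D. the (D (act E x b)) = act E (the (D x)) b)"

text \<open>The adjoint; it is meant for densely defined \<open>D\<close>, for which \<open>z\<close> is unique.\<close>

definition adj_op ::
    "('e::{complex_vector, banach}, 'b::z2_graded_cstar_algebra) hmod
      \<Rightarrow> ('e \<rightharpoonup> 'e) \<Rightarrow> ('e \<rightharpoonup> 'e)" where
  "adj_op E D = (\<lambda>y.
     if \<exists>z. \<forall>x\<in>dom D. inn E (the (D x)) y = inn E x z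
     then Some (THE z. \<forall>x\<in>dom D. inn E (the (D x)) y = inn E x z)
     else None)"

definition regular_op ::
    "('e::{complex_vector, banach}, 'b::z2_graded_cstar_algebra) hmod \<Rightarrow> ('e \<rightharpoonup> 'e) \<Rightarrow> bool" where
  "regular_op E D \<longleftrightarrow>
     linear_op E D \<and> closed (Map.graph D) \<and>
     closure (dom D) = UNIV \<and> closure (dom (adj_op E D)) = UNIV \<and>
     closure (ran (plus_op (adj_op E D \<circ>\<^sub>m D) id_blinfun)) = UNIV"

definition regular_selfadjoint ::
    "('e::{complex_vector, banach}, 'b::z2_graded_cstar_algebra) hmod \<Rightarrow> ('e \<rightharpoonup> 'e) \<Rightarrow> bool" where
  "regular_selfadjoint E D \<longleftrightarrow> regular_op E D \<and> adj_op E D = D"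

definition positive_op ::
    "('e::{complex_vector, banach}, 'b::z2_graded_cstar_algebra) hmod \<Rightarrow> ('e \<rightharpoonup> 'e) \<Rightarrow> bool" where
  "positive_op E P \<longleftrightarrow> (\<forall>x\<in>dom P. pos_elem (inn E (the (P x)) x))"

definition odd_op ::
    "('e::{complex_vector, banach}, 'b::z2_graded_cstar_algebra) hmod \<Rightarrow> ('e \<rightharpoonup> 'e) \<Rightarrow> bool" where
  "odd_op E D \<longleftrightarrow>
     (\<forall>x\<in>dom D. mgrading E x \<in> dom D \<and> the (D (mgrading E x)) = - mgrading E (the (D x)))"

definition is_inverse_op ::
    "('e::{complex_vector, banach}, 'b::z2_graded_cstar_algebra) hmod
      \<Rightarrow> ('e \<rightharpoonup> 'e) \<Rightarrow> ('e \<Rightarrow>\<^sub>L 'e) \<Rightarrow> bool" where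
  "is_inverse_op E P R \<longleftrightarrow>
     R \<in> End_adj E \<and> (\<forall>x. R x \<in> dom P \<and> the (P (R x)) = x) \<and> (\<forall>x\<in>dom P. R (the (P x)) = x)"

definition invertible_op ::
    "('e::{complex_vector, banach}, 'b::z2_graded_cstar_algebra) hmod \<Rightarrow> ('e \<rightharpoonup> 'e) \<Rightarrow> bool" where
  "invertible_op E P \<longleftrightarrow> (\<exists>R. is_inverse_op E P R)"

definition inverse_op ::
    "('e::{complex_vector, banach}, 'b::z2_graded_cstar_algebra) hmod
      \<Rightarrow> ('e \<rightharpoonup> 'e) \<Rightarrow> ('e \<Rightarrow>\<^sub>L 'e)" where
  "inverse_op E P = (THE R. is_inverse_op E P R)"

text \<open>The positive square root of a positive element of \<open>End_adj E\<close>.\<close>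

definition sqrt_op ::
    "('e::{complex_vector, banach}, 'b::z2_graded_cstar_algebra) hmod
      \<Rightarrow> ('e \<Rightarrow>\<^sub>L 'e) \<Rightarrow> ('e \<Rightarrow>\<^sub>L 'e)" where
  "sqrt_op E T = (THE R. R \<in> End_adj E \<and> positive_op E (total_op R) \<and> R o\<^sub>L R = T)"

text \<open>\<open>(1 + D\<^sup>2)\<^bsup>-1/2\<^esup>\<close>, for regular self-adjoint \<open>D\<close>.\<close>

definition inv_sqrt_one_plus_sq ::
    "('e::{complex_vector, banach}, 'b::z2_graded_cstar_algebra) hmod
      \<Rightarrow> ('e \<rightharpoonup> 'e) \<Rightarrow> ('e \<Rightarrow>\<^sub>L 'e)" where
  "inv_sqrt_one_plus_sq E D = sqrt_op E (inverse_op E (plus_op (D \<circ>\<^sub>m D) id_blinfun))"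

text \<open>\<open>|D| = (D\<^sup>2)\<^bsup>1/2\<^esup>\<close> and, for invertible \<open>D\<close>, \<open>sgn(D) = D|D|\<^bsup>-1\<^esup>\<close>, for regular self-adjoint
  \<open>D\<close>.\<close>

definition abs_op ::
    "('e::{complex_vector, banach}, 'b::z2_graded_cstar_algebra) hmod
      \<Rightarrow> ('e \<rightharpoonup> 'e) \<Rightarrow> ('e \<rightharpoonup> 'e)" where
  "abs_op E D = (THE P. regular_selfadjoint E P \<and> positive_op E P \<and> P \<circ>\<^sub>m P = D \<circ>\<^sub>m D)"

definition sgn_op ::
    "('e::{complex_vector, banach}, 'b::z2_graded_cstar_algebra) hmod
      \<Rightarrow> ('e \<rightharpoonup> 'e) \<Rightarrow> ('e \<Rightarrow>\<^sub>L 'e)" where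
  "sgn_op E D = (THE U. total_op U = D \<circ>\<^sub>m total_op (inverse_op E (abs_op E D)))"


section \<open>Unbounded cycles\<close>

definition Lip ::
    "('e::{complex_vector, banach}, 'b::z2_graded_cstar_algebra) hmod
      \<Rightarrow> ('e \<rightharpoonup> 'e) \<Rightarrow> ('e \<Rightarrow>\<^sub>L 'e) set" where
  "Lip E D = {T \<in> End_adj E.
     (\<forall>x\<in>dom D. T x \<in> dom D) \<and>
     (\<exists>C\<in>End_adj E. \<forall>x\<in>dom D. C x = gcomm E (\<lambda>x. the (D x)) T x)}"

definition Lip0 ::
    "('e::{complex_vector, banach}, 'b::z2_graded_cstar_algebra) hmod
      \<Rightarrow> ('e \<rightharpoonup> 'e) \<Rightarrow> ('e \<Rightarrow>\<^sub>L 'e) set" where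
  "Lip0 E D = {T \<in> Lip E D.
     T o\<^sub>L inv_sqrt_one_plus_sq E D \<in> End_cpt E \<and>
     adj E T o\<^sub>L inv_sqrt_one_plus_sq E D \<in> End_cpt E}"

definition graded_star_hom ::
    "('e::{complex_vector, banach}, 'b::z2_graded_cstar_algebra) hmod
      \<Rightarrow> ('a::z2_graded_cstar_algebra \<Rightarrow> ('e \<Rightarrow>\<^sub>L 'e)) \<Rightarrow> bool" where
  "graded_star_hom E \<pi> \<longleftrightarrow>
     (\<forall>a. is_adjoint E (\<pi> a) (\<pi> (star a))) \<and>
     (\<forall>a b. \<pi> (a + b) = \<pi> a + \<pi> b) \<and>
     (\<forall>k a x. \<pi> (k *\<^sub>C a) x = k *\<^sub>C \<pi> a x) \<and>
     (\<forall>a b. \<pi> (a * b) = \<pi> a o\<^sub>L \<pi> b) \<and>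
     (\<forall>a x. \<pi> (grading a) x = mgrading E (\<pi> a (mgrading E x)))"

definition unbounded_cycle ::
    "('a::z2_graded_cstar_algebra \<Rightarrow> ('e \<Rightarrow>\<^sub>L 'e))
      \<Rightarrow> ('e::{complex_vector, banach}, 'b::z2_graded_cstar_algebra) hmod
      \<Rightarrow> ('e \<rightharpoonup> 'e) \<Rightarrow> bool" where
  "unbounded_cycle \<pi> E D \<longleftrightarrow>
     graded_hilbert_module E \<and> countably_generated E \<and> graded_star_hom E \<pi> \<and>
     regular_selfadjoint E D \<and> odd_op E D \<and>
     range \<pi> \<subseteq> closure (Lip0 E D)"

definition spectral_symmetry ::
    "('a::z2_graded_cstar_algebra \<Rightarrow> ('e \<Rightarrow>\<^sub>L 'e))
      \<Rightarrow> ('e::{complex_vector, banach}, 'b::z2_graded_cstar_algebra) hmod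
      \<Rightarrow> ('e \<rightharpoonup> 'e) \<Rightarrow> ('e \<Rightarrow>\<^sub>L 'e) \<Rightarrow> bool" where
  "spectral_symmetry \<pi> E D S \<longleftrightarrow>
     S \<in> End_adj E \<and> odd_op E (total_op S) \<and> adj E S = S \<and>
     adj E S o\<^sub>L S = id_blinfun \<and> S o\<^sub>L adj E S = id_blinfun \<and>
     (\<exists>W \<subseteq> Lip0 E D. range \<pi> \<subseteq> closure W \<and> (\<forall>w\<in>W. \<forall>x. gcomm E S w x = 0)) \<and>
     (\<forall>x\<in>dom D. S x \<in> dom D) \<and>
     (\<forall>x\<in>dom D. the (D (S x)) - S (the (D x)) = 0) \<and>
     positive_op E (total_op S \<circ>\<^sub>m D)"

definition spectrally_degenerate ::
    "('a::z2_graded_cstar_algebra \<Rightarrow> ('e \<Rightarrow>\<^sub>L 'e))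
      \<Rightarrow> ('e::{complex_vector, banach}, 'b::z2_graded_cstar_algebra) hmod
      \<Rightarrow> ('e \<rightharpoonup> 'e) \<Rightarrow> bool" where
  "spectrally_degenerate \<pi> E D \<longleftrightarrow>
     invertible_op E D \<and>
     (\<exists>W \<subseteq> Lip0 E D. range \<pi> \<subseteq> closure W \<and> (\<forall>w\<in>W. \<forall>x. gcomm E (sgn_op E D) w x = 0))"

end

theory Submission
  imports Defs
begin

text \<open>
  Put \<open>P = SD\<close>, which is self-adjoint and positive, and \<open>Q = S(D + S) = P + 1\<close>. By
  \<open>\<langle>Qx,Qx\<rangle> = \<langle>Px,Px\<rangle> + 2\<langle>Px,x\<rangle> + \<langle>x,x\<rangle>\<close>, \<open>\<parallel>(D + S)x\<parallel> = \<parallel>Qx\<parallel> \<ge> \<parallel>x\<parallel>\<close>, so the self-adjoint regular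
  operator \<open>D + S\<close> is invertible. As \<open>Q\<close> is positive with \<open>Q\<^sup>2 = (D + S)\<^sup>2\<close>, it is \<open>|D + S|\<close>, and
  \<open>sgn(D + S) = (D + S)Q\<^sup>-\<^sup>1 = S\<close> (\<open>spectral_symmetry_perturbation\<close>). The elements of \<open>W\<close> commute with \<open>S\<close> by
  assumption. It remains that \<open>W\<close> is still contained in \<open>Lip\<^sup>0(D + S)\<close> (\<open>Lip0_plus_op\<close>). The commutators with \<open>D\<close>
  and \<open>D + S\<close> coincide on \<open>W\<close>, and \<open>(1 + (D + S)\<^sup>2)\<^bsup>-1/2\<^esup> = (1 + D\<^sup>2)\<^bsup>-1/2\<^esup>X\<close> with an adjointable \<open>X\<close>, so that
  compactness is inherited (\<open>inv_sqrt_perturbation_factor\<close>).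

  The order-theoretic part rests on the inequality \<open>\<parallel>c\<^sup>*c\<parallel> \<le> \<parallel>c\<^sup>*c + d\<^sup>*d\<parallel>\<close> in \<open>B\<close>. In particular
  \<open>c\<^sup>*c + d\<^sup>*d = 0\<close> forces \<open>c = 0\<close>. It is derived from a description of positivity by the norm, \<open>\<parallel>t - a\<parallel> \<le> t\<close>, from square
  roots obtained by iteration, and from the theorem of Kelley and Vaught (\<open>norm_pos_adjoint_comp\<close>). The tools are
  developed for operators on an arbitrary Hilbert module and applied to \<open>B\<close> as a module over itself. They yield
  existence and uniqueness of positive roots of bounded operators. An unbounded positive root with a bounded inverse is
  then determined through that inverse (\<open>positive_root_unique_unbounded\<close>).

  Regular self-adjoint operators are handled as symmetric operators for which \<open>D + i\<close> and \<open>D - i\<close> are surjective.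
  Since \<open>\<parallel>(D \<plusminus> i)x\<parallel> \<ge> \<parallel>x\<parallel>\<close> for every symmetric \<open>D\<close>, a contraction argument shows that surjectivity persists
  when half of \<open>S\<close> is added, twice in succession (\<open>resolvent_plus_contraction\<close>).
\<close>

section \<open>Sesquilinear algebra in a Hilbert module\<close>

lemma blinfun_compose_assoc: "(a o\<^sub>L b) o\<^sub>L c = a o\<^sub>L (b o\<^sub>L c)"
  by (rule blinfun_eqI) simp

lemmas comp_simps =
  bounded_bilinear.add_left[OF bounded_bilinear_blinfun_compose]
  bounded_bilinear.add_right[OF bounded_bilinear_blinfun_compose]
  bounded_bilinear.diff_left[OF bounded_bilinear_blinfun_compose]
  bounded_bilinear.diff_right[OF bounded_bilinear_blinfun_compose]
  bounded_bilinear.minus_left[OF bounded_bilinear_blinfun_compose]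
  bounded_bilinear.minus_right[OF bounded_bilinear_blinfun_compose]
  bounded_bilinear.scaleR_left[OF bounded_bilinear_blinfun_compose]
  bounded_bilinear.scaleR_right[OF bounded_bilinear_blinfun_compose]
  blinfun_compose_assoc

lemma id_compose [simp]: "id_blinfun o\<^sub>L a = a" "a o\<^sub>L id_blinfun = a"
  by (auto intro: blinfun_eqI)

lemma scaleC_minus_one: "(-1) *\<^sub>C x = - (x::'a::complex_vector)"
  using scaleC_of_real[of "-1" x] by simp

lemma scaleC_one [simp]: "1 *\<^sub>C x = (x::'a::complex_vector)"
  using scaleC_of_real[of 1 x] by simp

lemma scaleC_zero_left [simp]: "0 *\<^sub>C x = (0::'a::complex_vector)"
  using scaleC_of_real[of 0 x] by simp

lemma scaleC_minus_right: "c *\<^sub>C (- x) = - (c *\<^sub>C (x::'a::complex_vector))"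
  using scaleC_scaleC[of c "-1" x] scaleC_scaleC[of "-1" c x] by (simp add: scaleC_minus_one)

lemma scaleC_minus_left: "(- c) *\<^sub>C x = - (c *\<^sub>C (x::'a::complex_vector))"
  using scaleC_scaleC[of "-1" c x] by (simp add: scaleC_minus_one)

lemma scaleC_diff_right: "c *\<^sub>C (x - y) = c *\<^sub>C x - c *\<^sub>C (y::'a::complex_vector)"
  using scaleC_add_right[of c x "-y"] by (simp add: scaleC_minus_right)

lemma scaleC_zero_right [simp]: "c *\<^sub>C 0 = (0::'a::complex_vector)"
  using scaleC_diff_right[of c 0 0] by simp

lemma scaleC_scaleR: "c *\<^sub>C (r *\<^sub>R x) = r *\<^sub>R (c *\<^sub>C (x::'a::complex_vector))"
  unfolding scaleC_of_real[symmetric] scaleC_scaleC by (simp add: mult.commute)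

lemma scaleC_i_i [simp]: "\<i> *\<^sub>C (\<i> *\<^sub>C x) = - (x::'a::complex_vector)"
  by (simp add: scaleC_scaleC scaleC_minus_one)

lemma star_scaleR: "star (r *\<^sub>R a) = r *\<^sub>R star (a::'b::cstar_algebra)"
  by (metis star_scaleC scaleC_of_real complex_cnj_complex_of_real)

lemma star_minus: "star (- a) = - star (a::'b::cstar_algebra)"
  using star_scaleR[of "-1" a] by simp

lemma star_diff: "star (a - b) = star a - star (b::'b::cstar_algebra)"
  using star_add[of a "-b"] by (simp add: star_minus)

lemma star_zero [simp]: "star 0 = (0::'b::cstar_algebra)"
  using star_diff[of 0 "0::'b"] by simp

lemma norm_star [simp]: "norm (star a) = norm (a::'b::cstar_algebra)"
proof -
  have le: "norm b \<le> norm (star b)" for b :: 'b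
  proof (cases "b = 0")
    case False
    have "norm b * norm b \<le> norm (star b) * norm b"
      using norm_mult_ineq[of "star b" b] by (simp add: cstar_identity power2_eq_square)
    then show ?thesis using False by (simp add: mult_le_cancel_right)
  qed simp
  from le[of a] le[of "star a"] show ?thesis by (simp add: star_star)
qed

lemma pos_elem_star: "pos_elem a \<Longrightarrow> star a = a"
  by (auto simp: pos_elem_def star_mult star_star)

lemma pos_elem_zero [simp]: "pos_elem 0"
  unfolding pos_elem_def by (rule exI[of _ 0]) simp

context graded_hilbert_module
begin

lemma inn_add_left: "inn E (x + y) z = inn E x z + inn E y z"
  by (metis inn_add_right inn_star star_add)

lemma inn_scaleC_left: "inn E (k *\<^sub>C x) y = cnj k *\<^sub>C inn E x y"
  by (metis inn_scaleC_right inn_star star_scaleC)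

lemma inn_scaleR_right: "inn E x (r *\<^sub>R y) = r *\<^sub>R inn E x y"
  by (metis inn_scaleC_right scaleC_of_real)

lemma inn_scaleR_left: "inn E (r *\<^sub>R x) y = r *\<^sub>R inn E x y"
  by (metis inn_scaleC_left scaleC_of_real complex_cnj_complex_of_real)

lemma inn_minus_right: "inn E x (- y) = - inn E x y"
  using inn_scaleR_right[of x "-1" y] by simp

lemma inn_minus_left: "inn E (- x) y = - inn E x y"
  using inn_scaleR_left[of "-1" x y] by simp

lemma inn_diff_right: "inn E x (y - z) = inn E x y - inn E x z"
  using inn_add_right[of x y "-z"] by (simp add: inn_minus_right)

lemma inn_diff_left: "inn E (x - y) z = inn E x z - inn E y z"
  using inn_add_left[of x "-y" z] by (simp add: inn_minus_left)

lemma inn_zero [simp]: "inn E x 0 = 0" "inn E 0 x = 0"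
  using inn_diff_right[of x 0 0] inn_diff_left[of 0 0 x] by auto

lemmas inn_simps = inn_add_left inn_add_right inn_diff_left inn_diff_right inn_minus_left
  inn_minus_right inn_scaleR_left inn_scaleR_right inn_scaleC_left inn_scaleC_right

lemma norm_sq: "(norm (x::'e))\<^sup>2 = norm (inn E x x)"
  by (subst norm_inn) simp

lemma norm_scaleC_module: "norm (k *\<^sub>C x) = cmod k * norm (x :: 'e)"
proof -
  have "inn E (k *\<^sub>C x) (k *\<^sub>C x) = cnj k *\<^sub>C k *\<^sub>C inn E x x" by (simp add: inn_simps scaleC_scaleC mult.commute)
  then have "norm (inn E (k *\<^sub>C x) (k *\<^sub>C x)) = (cmod k * norm x)\<^sup>2"
    by (simp only: norm_scaleC complex_mod_cnj power_mult_distrib norm_sq) (simp add: power2_eq_square)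
  then have "(norm (k *\<^sub>C x))\<^sup>2 = (cmod k * norm x)\<^sup>2" by (simp only: norm_sq)
  then show ?thesis by simp
qed

lemma norm_eqI: "inn E x x = inn E y y \<Longrightarrow> norm x = norm y"
  by (metis norm_inn)

lemma inn_right_eqI: "(\<And>x. inn E x y = inn E x z) \<Longrightarrow> y = z"
  using inn_definite[of "y - z"] by (simp add: inn_diff_right)

text \<open>If \<open>\<langle>x,y\<rangle>\<close> is self-adjoint, then \<open>x + iy\<close> and \<open>x - iy\<close> have the same length, and
  \<open>2x\<close> is their sum. So the bounds come from the triangle inequality of the module norm; deriving them
  from an order on \<open>B\<close> would presuppose the theorem of Kelley and Vaught.\<close>

lemma norm_le_norm_add_imul:
  assumes "inn E x y = inn E y x"
  shows "norm x \<le> norm (x + \<i> *\<^sub>C y)" and "norm y \<le> norm (x + \<i> *\<^sub>C y)"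
    and "(norm (x + \<i> *\<^sub>C y))\<^sup>2 = norm (inn E x x + inn E y y)"
proof -
  let ?p = "x + \<i> *\<^sub>C y" and ?m = "x - \<i> *\<^sub>C y"
  have p: "inn E ?p ?p = inn E x x + inn E y y"
    using assms by (simp add: inn_simps scaleC_minus_left scaleC_add_right scaleC_diff_right)
  have m: "inn E ?m ?m = inn E x x + inn E y y"
    using assms by (simp add: inn_simps scaleC_minus_left scaleC_add_right scaleC_diff_right)
  have eq: "norm ?m = norm ?p" by (rule norm_eqI) (simp add: p m)
  have "norm (2 *\<^sub>R x) = norm (?p + ?m)" by (simp add: scaleR_2)
  also have "\<dots> \<le> norm ?p + norm ?m" by (rule norm_triangle_ineq)
  finally show "norm x \<le> norm ?p" using eq by simp
  have "norm (2 *\<^sub>R (\<i> *\<^sub>C y)) = norm (?p - ?m)" by (simp add: scaleR_2)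
  also have "\<dots> \<le> norm ?p + norm ?m" by (rule norm_triangle_ineq4)
  finally show "norm y \<le> norm ?p" using eq by (simp add: norm_scaleC_module)
  show "(norm ?p)\<^sup>2 = norm (inn E x x + inn E y y)" by (simp add: norm_sq p)
qed

lemma norm_le_of_commuting:
  assumes "inn E x y = inn E y x"
  shows "(norm x)\<^sup>2 \<le> norm (inn E x x + inn E y y)"
    and "(norm y)\<^sup>2 \<le> norm (inn E x x + inn E y y)"
  using norm_le_norm_add_imul[OF assms] by (metis norm_ge_zero power_mono)+

text \<open>Polarization gives the Cauchy--Schwarz inequality up to the factor \<open>4\<close>, which suffices for the
  continuity of the inner product.\<close>

lemma polarization:
  "4 *\<^sub>R inn E x y = (inn E (x + y) (x + y) - inn E (x - y) (x - y))
     - \<i> *\<^sub>C (inn E (x + \<i> *\<^sub>C y) (x + \<i> *\<^sub>C y) - inn E (x - \<i> *\<^sub>C y) (x - \<i> *\<^sub>C y))"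
proof -
  have 1: "inn E (x + y) (x + y) - inn E (x - y) (x - y) = 2 *\<^sub>R (inn E x y + inn E y x)"
    by (simp add: inn_simps scaleR_2)
  have 2: "inn E (x + \<i> *\<^sub>C y) (x + \<i> *\<^sub>C y) - inn E (x - \<i> *\<^sub>C y) (x - \<i> *\<^sub>C y)
      = 2 *\<^sub>R (\<i> *\<^sub>C (inn E x y - inn E y x))"
    by (simp add: inn_simps scaleR_2 scaleC_scaleC scaleC_minus_left scaleC_diff_right scaleC_add_right)
  show ?thesis
    unfolding 1 2 by (simp add: scaleC_scaleR algebra_simps flip: scaleR_add_left)
qed

lemma norm_inn_unit_le:
  assumes "norm x \<le> 1" "norm y \<le> 1" shows "norm (inn E x y) \<le> 4"
proof -
  have b: "norm (inn E z z) \<le> 4" if "norm z \<le> 2" for z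
    using power_mono[OF that norm_ge_zero, of 2] by (simp add: norm_sq)
  have n: "norm (\<i> *\<^sub>C y) \<le> 1" using assms by (simp add: norm_scaleC_module)
  have c: "norm (x + w) \<le> 2" "norm (x - w) \<le> 2" if "norm w \<le> 1" for w
    using that assms(1) norm_triangle_ineq[of x w] norm_triangle_ineq4[of x w] by linarith+
  have d: "norm (inn E (x + w) (x + w) - inn E (x - w) (x - w)) \<le> 8" if "norm w \<le> 1" for w
    using norm_triangle_ineq4[of "inn E (x + w) (x + w)" "inn E (x - w) (x - w)"]
      b[OF c(1)[OF that]] b[OF c(2)[OF that]] by linarith
  have "norm (4 *\<^sub>R inn E x y) \<le> 8 + 8"
    unfolding polarization
  proof (rule order_trans[OF norm_triangle_ineq4 add_mono])
    show "norm (inn E (x + y) (x + y) - inn E (x - y) (x - y)) \<le> 8" by (rule d[OF assms(2)])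
    show "norm (\<i> *\<^sub>C (inn E (x + \<i> *\<^sub>C y) (x + \<i> *\<^sub>C y)
        - inn E (x - \<i> *\<^sub>C y) (x - \<i> *\<^sub>C y))) \<le> 8"
      using d[OF n] unfolding norm_scaleC by simp
  qed
  then show ?thesis by simp
qed

lemma norm_inn_le: "norm (inn E x y) \<le> norm x * norm y * 4"
proof (cases "x = 0 \<or> y = 0")
  case False
  have "norm (inn E ((1 / norm x) *\<^sub>R x) ((1 / norm y) *\<^sub>R y)) \<le> 4"
    by (rule norm_inn_unit_le) auto
  then show ?thesis using False by (simp add: inn_simps field_simps)
qed auto

lemma bounded_bilinear_inn: "bounded_bilinear (inn E)"
proof
  show "\<exists>K. \<forall>x y. norm (inn E x y) \<le> norm x * norm y * K"
    using norm_inn_le by blast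
qed (auto simp: inn_simps)

lemmas tendsto_inn = bounded_bilinear.tendsto[OF bounded_bilinear_inn]

lemma inn_right_eqI_dense:
  assumes "closure M = UNIV" "\<And>x. x \<in> M \<Longrightarrow> inn E x y = inn E x z"
  shows "y = z"
proof (rule inn_right_eqI)
  fix x
  have "x \<in> closure M" using assms by simp
  then obtain s where s: "\<And>n. s n \<in> M" "s \<longlonglongrightarrow> x" unfolding closure_sequential by blast
  have "(\<lambda>n. inn E (s n) y) \<longlonglongrightarrow> inn E x y" "(\<lambda>n. inn E (s n) z) \<longlonglongrightarrow> inn E x z"
    by (intro tendsto_inn s tendsto_const)+
  then show "inn E x y = inn E x z" using assms(2)[OF s(1)] LIMSEQ_unique by simp
qed


section \<open>Adjointable operators\<close>

lemma is_adjoint_sym: "is_adjoint E T T' \<Longrightarrow> is_adjoint E T' T"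
  unfolding is_adjoint_def by (metis inn_star)

lemma is_adjoint_unique: "is_adjoint E T T' \<Longrightarrow> is_adjoint E T T'' \<Longrightarrow> T' = T''"
  unfolding is_adjoint_def by (metis inn_right_eqI blinfun_eqI)

lemma adj_eqI: "is_adjoint E T T' \<Longrightarrow> adj E T = T'"
  unfolding adj_def by (blast intro: is_adjoint_unique)

lemma is_adjoint_id: "is_adjoint E id_blinfun id_blinfun"
  by (simp add: is_adjoint_def)

lemma is_adjoint_zero: "is_adjoint E 0 0"
  by (simp add: is_adjoint_def)

lemma is_adjoint_add:
  "is_adjoint E S S' \<Longrightarrow> is_adjoint E T T' \<Longrightarrow> is_adjoint E (S + T) (S' + T')"
  by (simp add: is_adjoint_def blinfun.bilinear_simps inn_simps)

lemma is_adjoint_diff: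
  "is_adjoint E S S' \<Longrightarrow> is_adjoint E T T' \<Longrightarrow> is_adjoint E (S - T) (S' - T')"
  by (simp add: is_adjoint_def blinfun.bilinear_simps inn_simps)

lemma is_adjoint_minus: "is_adjoint E S S' \<Longrightarrow> is_adjoint E (- S) (- S')"
  by (simp add: is_adjoint_def blinfun.bilinear_simps inn_simps)

lemma is_adjoint_scaleR: "is_adjoint E S S' \<Longrightarrow> is_adjoint E (r *\<^sub>R S) (r *\<^sub>R S')"
  by (simp add: is_adjoint_def blinfun.bilinear_simps inn_simps)

lemma is_adjoint_comp:
  "is_adjoint E S S' \<Longrightarrow> is_adjoint E T T' \<Longrightarrow> is_adjoint E (S o\<^sub>L T) (T' o\<^sub>L S')"
  by (simp add: is_adjoint_def)

lemmas is_adjoint_intros = is_adjoint_id is_adjoint_zero is_adjoint_add is_adjoint_diff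
  is_adjoint_minus is_adjoint_scaleR is_adjoint_comp

lemma is_adjoint_comp_self:
  assumes "is_adjoint E S S" "is_adjoint E T T" "S o\<^sub>L T = T o\<^sub>L S"
  shows "is_adjoint E (S o\<^sub>L T) (S o\<^sub>L T)"
  using is_adjoint_comp[OF assms(1,2)] assms(3) by simp

lemma is_adjoint_limit:
  assumes "\<And>n. is_adjoint E (S n) (S n)" "S \<longlonglongrightarrow> T"
  shows "is_adjoint E T T"
  unfolding is_adjoint_def
proof (intro allI)
  fix x y
  have lim: "(\<lambda>n. S n z) \<longlonglongrightarrow> T z" for z
    by (intro bounded_bilinear.tendsto[OF bounded_bilinear_blinfun_apply] assms tendsto_const)
  have "(\<lambda>n. inn E (S n x) y) \<longlonglongrightarrow> inn E (T x) y" "(\<lambda>n. inn E x (S n y)) \<longlonglongrightarrow> inn E x (T y)"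
    by (intro tendsto_inn lim tendsto_const)+
  then show "inn E (T x) y = inn E x (T y)"
    using assms(1) LIMSEQ_unique unfolding is_adjoint_def by simp
qed

lemma comp_adjoint_zero:
  assumes "is_adjoint E T T'" "T' o\<^sub>L T = 0" shows "T = 0"
proof (rule blinfun_eqI)
  fix x
  have "inn E (T x) (T x) = inn E x ((T' o\<^sub>L T) x)" using assms(1) by (simp add: is_adjoint_def)
  then show "T x = (0 :: 'e \<Rightarrow>\<^sub>L 'e) x" using assms(2) inn_definite by simp
qed

lemma selfadjoint_square_zero: "is_adjoint E T T \<Longrightarrow> T o\<^sub>L T = 0 \<Longrightarrow> T = 0"
  by (rule comp_adjoint_zero)

lemma adjointable_scaleC:
  assumes "is_adjoint E T T'" shows "T (k *\<^sub>C x) = k *\<^sub>C T x"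
proof (rule inn_right_eqI)
  fix y show "inn E y (T (k *\<^sub>C x)) = inn E y (k *\<^sub>C T x)"
    using is_adjoint_sym[OF assms] unfolding is_adjoint_def by (metis inn_scaleC_right)
qed

lemma adjointable_act:
  assumes "is_adjoint E T T'" shows "T (act E x b) = act E (T x) b"
proof (rule inn_right_eqI)
  fix y show "inn E y (T (act E x b)) = inn E y (act E (T x) b)"
    using is_adjoint_sym[OF assms] unfolding is_adjoint_def by (metis inn_act_right)
qed

definition imul :: "'e \<Rightarrow>\<^sub>L 'e" where "imul = Blinfun (\<lambda>x. \<i> *\<^sub>C x)"

lemma imul_apply [simp]: "imul x = \<i> *\<^sub>C x"
proof -
  have "bounded_linear (\<lambda>x::'e. \<i> *\<^sub>C x)"
    by (rule bounded_linear_intro[where K=1])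
      (auto simp: scaleC_add_right scaleC_scaleR norm_scaleC_module)
  then show ?thesis by (simp add: imul_def bounded_linear_Blinfun_apply)
qed

lemma is_adjoint_imul: "is_adjoint E imul (- imul)"
  by (simp add: is_adjoint_def blinfun.bilinear_simps inn_simps scaleC_minus_left)

lemma imul_imul: "imul o\<^sub>L imul = - id_blinfun"
  by (rule blinfun_eqI) (simp add: blinfun.bilinear_simps)

lemma imul_commute: "is_adjoint E T T' \<Longrightarrow> imul o\<^sub>L T = T o\<^sub>L imul"
  by (rule blinfun_eqI) (simp add: adjointable_scaleC)

end


section \<open>Square roots by iteration\<close>

text \<open>Solving \<open>y = (x + y\<^sup>2) / 2\<close> yields \<open>(1 - y)\<^sup>2 = 1 - x\<close>. All iterates are polynomials
  in \<open>x\<close> with nonnegative coefficients, so for \<open>\<parallel>x\<parallel> \<le> 1\<close> their increments are dominated by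
  those of the scalar iteration with \<open>x = 1\<close>, which increases to at most \<open>1\<close>.\<close>

primrec sqrt_iter :: "('e::real_normed_vector \<Rightarrow>\<^sub>L 'e) \<Rightarrow> nat \<Rightarrow> ('e \<Rightarrow>\<^sub>L 'e)" where
  "sqrt_iter x 0 = 0"
| "sqrt_iter x (Suc n) = (1/2) *\<^sub>R (x + (sqrt_iter x n o\<^sub>L sqrt_iter x n))"

primrec sqrt_bound :: "nat \<Rightarrow> real" where
  "sqrt_bound 0 = 0"
| "sqrt_bound (Suc n) = (1 + (sqrt_bound n)\<^sup>2) / 2"

lemma sqrt_bound_range: "0 \<le> sqrt_bound n \<and> sqrt_bound n \<le> 1"
proof (induction n)
  case (Suc n)
  then have "(sqrt_bound n)\<^sup>2 \<le> 1" by (simp add: power_le_one)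
  then show ?case by simp
qed simp

lemma sqrt_bound_mono: "sqrt_bound n \<le> sqrt_bound (Suc n)"
  using zero_le_power2[of "1 - sqrt_bound n"] by (simp add: power2_eq_square algebra_simps)

lemma convergent_sqrt_bound: "convergent sqrt_bound"
  by (rule Bseq_mono_convergent)
    (auto intro!: BseqI'[where K=1] lift_Suc_mono_le sqrt_bound_mono simp: sqrt_bound_range abs_le_iff
      order_trans[OF _ sqrt_bound_range[THEN conjunct1]])

lemma norm_sqrt_iter_le:
  assumes "norm x \<le> 1" shows "norm (sqrt_iter x n) \<le> sqrt_bound n"
proof (induction n)
  case (Suc n)
  have "norm (sqrt_iter x n o\<^sub>L sqrt_iter x n) \<le> sqrt_bound n * sqrt_bound n"
    by (rule order_trans[OF norm_blinfun_compose mult_mono[OF Suc Suc]])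
      (auto simp: sqrt_bound_range)
  then have "norm (x + (sqrt_iter x n o\<^sub>L sqrt_iter x n)) \<le> 1 + (sqrt_bound n)\<^sup>2"
    using assms norm_triangle_ineq[of x "sqrt_iter x n o\<^sub>L sqrt_iter x n"]
    by (simp add: power2_eq_square)
  then show ?case by simp
qed simp

lemma norm_sqrt_iter_step:
  assumes "norm x \<le> 1"
  shows "norm (sqrt_iter x (Suc n) - sqrt_iter x n) \<le> sqrt_bound (Suc n) - sqrt_bound n"
proof (induction n)
  case 0 then show ?case using assms by simp
next
  case (Suc n)
  let ?y = "sqrt_iter x" and ?s = sqrt_bound
  let ?d = "?y (Suc n) - ?y n"
  have split: "?y (Suc (Suc n)) - ?y (Suc n) = (1/2) *\<^sub>R ((?y (Suc n) o\<^sub>L ?d) + (?d o\<^sub>L ?y n))"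
    by (subst (1 2) sqrt_iter.simps(2), simp only: scaleR_diff_right[symmetric])
      (simp del: sqrt_iter.simps add: comp_simps)
  have "norm (?y (Suc n) o\<^sub>L ?d) \<le> ?s (Suc n) * (?s (Suc n) - ?s n)"
    by (rule order_trans[OF norm_blinfun_compose mult_mono[OF norm_sqrt_iter_le[OF assms] Suc]])
      (use sqrt_bound_range in auto)
  moreover have "norm (?d o\<^sub>L ?y n) \<le> (?s (Suc n) - ?s n) * ?s n"
    by (rule order_trans[OF norm_blinfun_compose mult_mono[OF Suc norm_sqrt_iter_le[OF assms]]])
      (use sqrt_bound_mono[of n] in auto)
  ultimately have "norm ((?y (Suc n) o\<^sub>L ?d) + (?d o\<^sub>L ?y n))
      \<le> ?s (Suc n) * (?s (Suc n) - ?s n) + (?s (Suc n) - ?s n) * ?s n"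
    by (rule order_trans[OF norm_triangle_ineq add_mono])
  also have "\<dots> = 2 * (?s (Suc (Suc n)) - ?s (Suc n))"
    by (subst (3) sqrt_bound.simps(2), subst (4) sqrt_bound.simps(2))
      (simp del: sqrt_bound.simps add: power2_eq_square algebra_simps)
  finally show ?case unfolding split by (simp del: sqrt_iter.simps sqrt_bound.simps)
qed

lemma convergent_sqrt_iter:
  fixes x :: "'e::banach \<Rightarrow>\<^sub>L 'e"
  assumes "norm x \<le> 1" shows "convergent (sqrt_iter x)"
proof -
  have "summable (\<lambda>n. sqrt_bound (Suc n) - sqrt_bound n)"
    using convergent_sqrt_bound telescope_summable unfolding convergent_def by blast
  then have "summable (\<lambda>n. sqrt_iter x (Suc n) - sqrt_iter x n)"
    by (rule summable_comparison_test'[where N=0]) (rule norm_sqrt_iter_step[OF assms])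
  then have "convergent (\<lambda>n. \<Sum>i<n. sqrt_iter x (Suc i) - sqrt_iter x i)"
    by (simp only: summable_iff_convergent)
  then show ?thesis by (simp only: sum_lessThan_telescope) simp
qed

context graded_hilbert_module
begin

lemma sqrt_one_minus:
  assumes x: "is_adjoint E x x" "norm x \<le> 1"
  obtains y where "is_adjoint E y y" "norm y \<le> 1"
    "(id_blinfun - y) o\<^sub>L (id_blinfun - y) = id_blinfun - x"
    "\<And>u. u o\<^sub>L x = x o\<^sub>L u \<Longrightarrow> u o\<^sub>L y = y o\<^sub>L u"
proof -
  obtain y where y: "sqrt_iter x \<longlonglongrightarrow> y"
    using convergent_sqrt_iter[OF x(2)] unfolding convergent_def by blast
  note tendsto_comp = bounded_bilinear.tendsto[OF bounded_bilinear_blinfun_compose]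
  have sa: "is_adjoint E (sqrt_iter x n) (sqrt_iter x n)" for n
    by (induction n) (auto intro!: is_adjoint_intros x)
  have "norm (sqrt_iter x n) \<le> 1" for n
    using norm_sqrt_iter_le[OF x(2), of n] sqrt_bound_range[of n] by linarith
  then have 2: "norm y \<le> 1" by (intro LIMSEQ_le_const2[OF tendsto_norm[OF y]]) auto
  have "(\<lambda>n. sqrt_iter x (Suc n)) \<longlonglongrightarrow> (1/2) *\<^sub>R (x + (y o\<^sub>L y))"
    unfolding sqrt_iter.simps by (intro tendsto_intros tendsto_comp y)
  moreover have "(\<lambda>n. sqrt_iter x (Suc n)) \<longlonglongrightarrow> y" using y by (rule LIMSEQ_Suc)
  ultimately have fixpoint: "y = (1/2) *\<^sub>R (x + (y o\<^sub>L y))" using LIMSEQ_unique by blast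
  have "2 *\<^sub>R y = 2 *\<^sub>R ((1/2) *\<^sub>R (x + (y o\<^sub>L y)))" using fixpoint by (rule arg_cong)
  then have two: "2 *\<^sub>R y = x + (y o\<^sub>L y)" by simp
  have "(id_blinfun - y) o\<^sub>L (id_blinfun - y) = id_blinfun - 2 *\<^sub>R y + (y o\<^sub>L y)"
    by (simp add: comp_simps scaleR_2)
  then have 3: "(id_blinfun - y) o\<^sub>L (id_blinfun - y) = id_blinfun - x"
    unfolding two by simp
  have 4: "u o\<^sub>L y = y o\<^sub>L u" if u: "u o\<^sub>L x = x o\<^sub>L u" for u
  proof -
    have c: "u o\<^sub>L sqrt_iter x n = sqrt_iter x n o\<^sub>L u" for n
    proof (induction n)
      case (Suc n)
      have "u o\<^sub>L (sqrt_iter x n o\<^sub>L sqrt_iter x n) = sqrt_iter x n o\<^sub>L (sqrt_iter x n o\<^sub>L u)"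
        unfolding blinfun_compose_assoc[symmetric] Suc unfolding blinfun_compose_assoc Suc ..
      then show ?case using u by (simp add: comp_simps)
    qed simp
    have "(\<lambda>n. u o\<^sub>L sqrt_iter x n) \<longlonglongrightarrow> (u o\<^sub>L y)" "(\<lambda>n. sqrt_iter x n o\<^sub>L u) \<longlonglongrightarrow> (y o\<^sub>L u)"
      by (intro tendsto_comp y tendsto_const)+
    then show ?thesis using c LIMSEQ_unique by simp
  qed
  show ?thesis by (rule that[OF is_adjoint_limit[OF sa y] 2 3 4])
qed


section \<open>Positive operators through the norm\<close>

text \<open>For self-adjoint \<open>a\<close>, the condition \<open>\<parallel>t - a\<parallel> \<le> t\<close> says that the spectrum of \<open>a\<close> lies in
  \<open>[0, 2t]\<close>. In this form positivity visibly passes to sums, which is hard to see for the form \<open>T\<^sup>*T\<close>;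
  square roots and the theorem of Kelley and Vaught below make the two forms equivalent.\<close>

definition norm_pos :: "('e \<Rightarrow>\<^sub>L 'e) \<Rightarrow> bool" where
  "norm_pos a \<longleftrightarrow> is_adjoint E a a \<and> (\<exists>t\<ge>0. norm (t *\<^sub>R id_blinfun - a) \<le> t)"

lemma norm_pos_selfadjoint: "norm_pos a \<Longrightarrow> is_adjoint E a a"
  by (simp add: norm_pos_def)

lemma norm_pos_add: assumes "norm_pos a" "norm_pos b" shows "norm_pos (a + b)"
proof -
  obtain s t where st: "s \<ge> 0" "norm (s *\<^sub>R id_blinfun - a) \<le> s"
      "t \<ge> 0" "norm (t *\<^sub>R id_blinfun - b) \<le> t"
    using assms unfolding norm_pos_def by blast
  have "norm ((s + t) *\<^sub>R id_blinfun - (a + b)) \<le> s + t"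
    using norm_triangle_ineq[of "s *\<^sub>R id_blinfun - a" "t *\<^sub>R id_blinfun - b"] st(2,4)
    by (simp add: algebra_simps)
  then show ?thesis using assms st(1,3) is_adjoint_add unfolding norm_pos_def
    by (metis add_nonneg_nonneg)
qed

lemma norm_pos_scaleR: assumes "norm_pos a" "r \<ge> 0" shows "norm_pos (r *\<^sub>R a)"
proof -
  obtain s where s: "s \<ge> 0" "norm (s *\<^sub>R id_blinfun - a) \<le> s"
    using assms unfolding norm_pos_def by blast
  have "norm ((r * s) *\<^sub>R id_blinfun - r *\<^sub>R a) = r * norm (s *\<^sub>R id_blinfun - a)"
    using assms(2) by (simp flip: scaleR_scaleR scaleR_diff_right)
  also have "\<dots> \<le> r * s" using s assms(2) by (simp add: mult_left_mono)
  finally show ?thesis using assms s(1) is_adjoint_scaleR unfolding norm_pos_def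
    by (metis mult_nonneg_nonneg)
qed

lemma norm_pos_one_minus:
  assumes "is_adjoint E a a" "norm a \<le> 1" shows "norm_pos (id_blinfun - a)"
  unfolding norm_pos_def using assms by (auto intro!: is_adjoint_intros exI[of _ 1])

lemma norm_pos_sqrt:
  assumes a: "norm_pos a"
  obtains r where "norm_pos r" "r o\<^sub>L r = a" "\<And>u. u o\<^sub>L a = a o\<^sub>L u \<Longrightarrow> u o\<^sub>L r = r o\<^sub>L u"
proof -
  obtain t where t: "t \<ge> 0" "norm (t *\<^sub>R id_blinfun - a) \<le> t" using a unfolding norm_pos_def by blast
  show ?thesis
  proof (cases "t = 0")
    case True
    then have "a = 0" using t by simp
    then show ?thesis using that[of 0] a by simp
  next
    case False
    then have tp: "t > 0" using t by simp
    define x where "x = id_blinfun - (1/t) *\<^sub>R a"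
    have x_eq: "x = (1/t) *\<^sub>R (t *\<^sub>R id_blinfun - a)" using tp by (simp add: x_def algebra_simps)
    have "is_adjoint E x x"
      unfolding x_def by (intro is_adjoint_intros norm_pos_selfadjoint a)
    moreover have "norm x \<le> 1"
      using t tp unfolding x_eq norm_scaleR by (simp add: field_simps)
    ultimately have x: "is_adjoint E x x" "norm x \<le> 1" by auto
    obtain y where y: "is_adjoint E y y" "norm y \<le> 1"
      "(id_blinfun - y) o\<^sub>L (id_blinfun - y) = id_blinfun - x"
      "\<And>u. u o\<^sub>L x = x o\<^sub>L u \<Longrightarrow> u o\<^sub>L y = y o\<^sub>L u" using sqrt_one_minus[OF x] by metis
    have 1: "norm_pos (sqrt t *\<^sub>R (id_blinfun - y))"
      by (intro norm_pos_scaleR norm_pos_one_minus y) (use t in simp)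
    have "(sqrt t *\<^sub>R (id_blinfun - y)) o\<^sub>L (sqrt t *\<^sub>R (id_blinfun - y))
        = (sqrt t * sqrt t) *\<^sub>R ((id_blinfun - y) o\<^sub>L (id_blinfun - y))"
      by (simp only: comp_simps(7,8) scaleR_scaleR)
    also have "\<dots> = a" using tp by (simp add: y(3) x_def)
    finally have 2: "(sqrt t *\<^sub>R (id_blinfun - y)) o\<^sub>L (sqrt t *\<^sub>R (id_blinfun - y)) = a" .
    have 3: "u o\<^sub>L (sqrt t *\<^sub>R (id_blinfun - y)) = (sqrt t *\<^sub>R (id_blinfun - y)) o\<^sub>L u"
      if "u o\<^sub>L a = a o\<^sub>L u" for u
    proof -
      have "u o\<^sub>L x = x o\<^sub>L u" using that by (simp add: x_def comp_simps)
      then show ?thesis using y(4) by (simp add: comp_simps)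
    qed
    show ?thesis by (rule that[OF 1 2 3])
  qed
qed

text \<open>The bound expresses that \<open>r\<^sup>2 + q\<^sup>2 \<le> c\<^sup>2\<close>. For \<open>r\<^sup>2 + q\<^sup>2 = 1\<close> the operator \<open>r + iq\<close> is unitary, and
  \<open>r\<close> and \<open>q\<close> are its real and imaginary part.\<close>

lemma commuting_squares_norm_le:
  assumes "is_adjoint E r r" "is_adjoint E q q" "r o\<^sub>L q = q o\<^sub>L r"
    and le: "\<And>x. norm (inn E x (((r o\<^sub>L r) + (q o\<^sub>L q)) x)) \<le> (c * norm x)\<^sup>2" and "c \<ge> 0"
  shows "norm r \<le> c" and "norm q \<le> c"
proof -
  have comm: "inn E (r x) (q x) = inn E (q x) (r x)" for x
  proof -
    have "inn E (r x) (q x) = inn E x ((r o\<^sub>L q) x)" using assms(1) by (simp add: is_adjoint_def)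
    also have "\<dots> = inn E (q x) (r x)" using assms(2) unfolding assms(3) by (simp add: is_adjoint_def)
    finally show ?thesis .
  qed
  have sum: "inn E (r x) (r x) + inn E (q x) (q x) = inn E x (((r o\<^sub>L r) + (q o\<^sub>L q)) x)" for x
    using assms(1,2) by (simp add: is_adjoint_def blinfun.bilinear_simps inn_simps)
  have "(norm (r x))\<^sup>2 \<le> (c * norm x)\<^sup>2" "(norm (q x))\<^sup>2 \<le> (c * norm x)\<^sup>2" for x
    using norm_le_of_commuting[OF comm[of x]] le[of x] unfolding sum by linarith+
  then have b: "norm (r x) \<le> c * norm x" "norm (q x) \<le> c * norm x" for x
    using \<open>c \<ge> 0\<close> by (auto intro: power2_le_imp_le)
  show "norm r \<le> c" "norm q \<le> c"
    using b \<open>c \<ge> 0\<close> by (auto intro!: norm_blinfun_bound)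
qed

lemma commuting_squares_contraction:
  assumes "is_adjoint E r r" "is_adjoint E q q" "r o\<^sub>L q = q o\<^sub>L r"
    and "(r o\<^sub>L r) + (q o\<^sub>L q) = id_blinfun"
  shows "norm r \<le> 1" and "norm q \<le> 1"
  using commuting_squares_norm_le[OF assms(1-3), of 1] assms(4) by (auto simp: norm_sq)

lemma norm_square_le: "norm r \<le> 1 \<Longrightarrow> norm (r o\<^sub>L r) \<le> 1"
  by (rule order_trans[OF norm_blinfun_compose]) (simp add: mult_le_one)

text \<open>After scaling to \<open>\<parallel>r\<parallel> \<le> 1\<close>, let \<open>q\<close> be the root of \<open>1 - r\<^sup>2\<close>. As \<open>r + iq\<close> is unitary,
  \<open>\<parallel>1 - r\<^sup>2\<parallel> = \<parallel>q\<^sup>2\<parallel> \<le> 1\<close>.\<close>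

lemma norm_pos_square:
  assumes r: "is_adjoint E r r" shows "norm_pos (r o\<^sub>L r)"
proof -
  have unit: "norm_pos (r o\<^sub>L r)" if r: "is_adjoint E r r" "norm r \<le> 1" for r
  proof -
    let ?x = "r o\<^sub>L r"
    have x: "is_adjoint E ?x ?x" by (intro is_adjoint_intros r)
    obtain y where y: "is_adjoint E y y"
      "(id_blinfun - y) o\<^sub>L (id_blinfun - y) = id_blinfun - ?x"
      "\<And>u. u o\<^sub>L ?x = ?x o\<^sub>L u \<Longrightarrow> u o\<^sub>L y = y o\<^sub>L u"
      using sqrt_one_minus[OF x norm_square_le[OF r(2)]] by metis
    have "r o\<^sub>L y = y o\<^sub>L r" by (rule y(3)) (simp add: blinfun_compose_assoc)
    then have ry: "r o\<^sub>L (id_blinfun - y) = (id_blinfun - y) o\<^sub>L r" by (simp add: comp_simps)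
    have "norm (id_blinfun - y) \<le> 1"
      by (rule commuting_squares_contraction(2)[OF r(1) is_adjoint_diff[OF is_adjoint_id y(1)] ry])
        (simp add: y(2))
    then have "norm (id_blinfun - ?x) \<le> 1" unfolding y(2)[symmetric] by (rule norm_square_le)
    then show ?thesis using x unfolding norm_pos_def by (auto intro!: exI[of _ 1])
  qed
  \<comment> \<open>the summand \<open>1\<close> keeps the scaling factor positive for \<open>r = 0\<close>\<close>
  define c where "c = norm r + 1"
  have c: "c > 0" by (simp add: c_def add_nonneg_pos)
  have "norm_pos (((1/c) *\<^sub>R r) o\<^sub>L ((1/c) *\<^sub>R r))"
    by (rule unit) (use c in \<open>auto intro!: is_adjoint_intros r simp: c_def\<close>)
  then have "norm_pos ((c*c) *\<^sub>R (((1/c) *\<^sub>R r) o\<^sub>L ((1/c) *\<^sub>R r)))"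
    by (rule norm_pos_scaleR) (use c in simp)
  moreover have "(c*c) *\<^sub>R (((1/c) *\<^sub>R r) o\<^sub>L ((1/c) *\<^sub>R r)) = r o\<^sub>L r"
    using c by (simp only: comp_simps(7,8) scaleR_scaleR) simp
  ultimately show ?thesis by simp
qed

text \<open>With \<open>a = r\<^sup>2\<close> and \<open>-a = s\<^sup>2\<close> for commuting \<open>r\<close> and \<open>s\<close>, the squares of \<open>r\<close> and \<open>s\<close> add up to \<open>0\<close>.\<close>

lemma norm_pos_antisym:
  assumes "norm_pos a" "norm_pos (- a)" shows "a = 0"
proof -
  obtain r where r: "norm_pos r" "r o\<^sub>L r = a" "\<And>u. u o\<^sub>L a = a o\<^sub>L u \<Longrightarrow> u o\<^sub>L r = r o\<^sub>L u"
    using norm_pos_sqrt[OF assms(1)] by metis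
  obtain s where s: "norm_pos s" "s o\<^sub>L s = - a"
      "\<And>u. u o\<^sub>L (-a) = (-a) o\<^sub>L u \<Longrightarrow> u o\<^sub>L s = s o\<^sub>L u"
    using norm_pos_sqrt[OF assms(2)] by metis
  have "r o\<^sub>L s = s o\<^sub>L r"
    by (rule s(3)) (simp add: comp_simps, simp add: r(2)[symmetric] blinfun_compose_assoc)
  then have "norm r \<le> 0"
    by (rule commuting_squares_norm_le(1)[OF norm_pos_selfadjoint[OF r(1)] norm_pos_selfadjoint[OF s(1)]])
      (simp_all add: r(2) s(2))
  then show ?thesis using r(2) by simp
qed

text \<open>If \<open>\<parallel>a + b\<parallel> \<le> 1\<close>, then \<open>1 - a = (1 - (a + b)) + b\<close> is positive as well, and the roots of \<open>a\<close> and \<open>1 - a\<close>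
  are commuting contractions.\<close>

lemma norm_le_of_norm_pos:
  assumes "norm_pos a" "norm_pos b" shows "norm a \<le> norm (a + b)"
proof -
  have unit: "norm a \<le> 1" if ab: "norm_pos a" "norm_pos b" "norm (a + b) \<le> 1" for a b
  proof -
    obtain r where r: "norm_pos r" "r o\<^sub>L r = a" "\<And>u. u o\<^sub>L a = a o\<^sub>L u \<Longrightarrow> u o\<^sub>L r = r o\<^sub>L u"
      using norm_pos_sqrt[OF ab(1)] by metis
    have "norm_pos ((id_blinfun - (a + b)) + b)"
      by (intro norm_pos_add norm_pos_one_minus norm_pos_selfadjoint ab)
    then have "norm_pos (id_blinfun - a)" by simp
    then obtain q where q: "norm_pos q" "q o\<^sub>L q = id_blinfun - a"
        "\<And>u. u o\<^sub>L (id_blinfun - a) = (id_blinfun - a) o\<^sub>L u \<Longrightarrow> u o\<^sub>L q = q o\<^sub>L u"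
      by (rule norm_pos_sqrt) blast
    have "r o\<^sub>L q = q o\<^sub>L r"
      by (rule q(3)) (simp add: comp_simps, simp add: r(2)[symmetric] blinfun_compose_assoc)
    then have "norm r \<le> 1"
      by (rule commuting_squares_contraction(1)[OF norm_pos_selfadjoint[OF r(1)] norm_pos_selfadjoint[OF q(1)]])
        (simp add: r(2) q(2))
    then show ?thesis unfolding r(2)[symmetric] by (rule norm_square_le)
  qed
  show ?thesis
  proof (rule dense_ge)
    fix c assume c: "norm (a + b) < c"
    then have cp: "c > 0" using norm_ge_zero[of "a + b"] by linarith
    have "norm ((1/c) *\<^sub>R a) \<le> 1"
    proof (rule unit)
      show "norm_pos ((1/c) *\<^sub>R a)" "norm_pos ((1/c) *\<^sub>R b)" using cp assms by (auto intro!: norm_pos_scaleR)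
      show "norm ((1/c) *\<^sub>R a + (1/c) *\<^sub>R b) \<le> 1" 
        using c cp unfolding scaleR_add_right[symmetric] norm_scaleR by (simp add: field_simps)
    qed
    then show "norm a \<le> c" using cp by (simp add: field_simps)
  qed
qed

text \<open>For \<open>c = x + iy\<close> with \<open>x\<close> and \<open>y\<close> self-adjoint the sum is \<open>2(x\<^sup>2 + y\<^sup>2)\<close>. In the proof \<open>p = 2x\<close> and
  \<open>q = -2y\<close>.\<close>

lemma norm_pos_sum_of_products:
  assumes c: "is_adjoint E c c'" shows "norm_pos ((c' o\<^sub>L c) + (c o\<^sub>L c'))"
proof -
  note c' = is_adjoint_sym[OF c]
  define p where "p = c + c'"
  define q where "q = imul o\<^sub>L (c - c')"
  have p: "is_adjoint E p p"
    using is_adjoint_add[OF c c'] by (simp add: p_def add.commute)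
  have "is_adjoint E q ((c' - c) o\<^sub>L (- imul))"
    unfolding q_def by (intro is_adjoint_intros is_adjoint_imul c c')
  moreover have "(c' - c) o\<^sub>L (- imul) = q"
    using imul_commute[OF c] imul_commute[OF c'] by (simp add: q_def comp_simps)
  ultimately have q: "is_adjoint E q q" by simp
  have "q o\<^sub>L q = (imul o\<^sub>L imul) o\<^sub>L ((c - c') o\<^sub>L (c - c'))"
  proof -
    have "q o\<^sub>L q = imul o\<^sub>L (((c - c') o\<^sub>L imul) o\<^sub>L (c - c'))"
      by (simp only: q_def blinfun_compose_assoc)
    then show ?thesis
      unfolding imul_commute[OF is_adjoint_diff[OF c c'], symmetric] by (simp only: blinfun_compose_assoc)
  qed
  then have qq: "q o\<^sub>L q = - ((c - c') o\<^sub>L (c - c'))"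
    by (simp add: imul_imul comp_simps)
  have "(c' o\<^sub>L c) + (c o\<^sub>L c') = (1/2) *\<^sub>R ((p o\<^sub>L p) + (q o\<^sub>L q))"
  proof -
    have "(p o\<^sub>L p) + (q o\<^sub>L q) = 2 *\<^sub>R ((c' o\<^sub>L c) + (c o\<^sub>L c'))"
      unfolding qq p_def scaleR_2 by (simp add: comp_simps add_ac)
    then show ?thesis by simp
  qed
  then show ?thesis using norm_pos_scaleR[OF norm_pos_add[OF norm_pos_square[OF p] norm_pos_square[OF q]], of "1/2"]
    by simp
qed

text \<open>The theorem of Kelley and Vaught. With \<open>h = T\<^sup>*T\<close> and \<open>m = (|h| - h)/2\<close>, the operator
  \<open>c = Tm\<close> satisfies \<open>c\<^sup>*c = mhm = -m\<^sup>3 = -k\<^sup>2\<close>, where \<open>k = |h|\<^bsup>1/2\<^esup>m\<close>; hence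
  \<open>cc\<^sup>* = (c\<^sup>*c + cc\<^sup>*) + k\<^sup>2\<close> is positive, say \<open>r\<^sup>2\<close>. The same computation for \<open>d = kc\<^sup>*\<close> gives
  \<open>d\<^sup>*d + dd\<^sup>* = -(r\<^sup>4 + k\<^sup>4)\<close>, in which one side is positive and the other one negative. So
  \<open>r = 0\<close> and \<open>m = 0\<close>.\<close>

theorem norm_pos_adjoint_comp:
  assumes T: "is_adjoint E T T'" shows "norm_pos (T' o\<^sub>L T)"
proof -
  note T' = is_adjoint_sym[OF T]
  define h where "h = T' o\<^sub>L T"
  have h: "is_adjoint E h h" unfolding h_def by (intro is_adjoint_intros T T')
  obtain a where a: "norm_pos a" "a o\<^sub>L a = h o\<^sub>L h"
      "\<And>u. u o\<^sub>L (h o\<^sub>L h) = (h o\<^sub>L h) o\<^sub>L u \<Longrightarrow> u o\<^sub>L a = a o\<^sub>L u"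
    using norm_pos_sqrt[OF norm_pos_square[OF h]] by metis
  have ha: "h o\<^sub>L a = a o\<^sub>L h" by (rule a(3)) (simp add: blinfun_compose_assoc)
  obtain \<rho> where \<rho>: "norm_pos \<rho>" "\<rho> o\<^sub>L \<rho> = a" "\<And>u. u o\<^sub>L a = a o\<^sub>L u \<Longrightarrow> u o\<^sub>L \<rho> = \<rho> o\<^sub>L u"
    using norm_pos_sqrt[OF a(1)] by metis
  define m where "m = (1/2) *\<^sub>R (a - h)"
  have m: "is_adjoint E m m"
    unfolding m_def by (intro is_adjoint_intros h norm_pos_selfadjoint[OF a(1)])
  have m\<rho>: "m o\<^sub>L \<rho> = \<rho> o\<^sub>L m" by (rule \<rho>(3)) (simp add: m_def comp_simps ha)
  \<comment> \<open>\<open>m + h = (|h| + h) / 2\<close> is the positive part of \<open>h\<close>, and the two parts annihilate each other\<close>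
  have hmm: "h o\<^sub>L m = - (m o\<^sub>L m)"
  proof -
    have "(a + h) o\<^sub>L (a - h) = 0" by (simp add: comp_simps ha a(2))
    then have "(a + h) o\<^sub>L m = 0" by (simp add: m_def comp_simps)
    moreover have "a + h = 2 *\<^sub>R (m + h)" by (simp add: m_def algebra_simps scaleR_2)
    ultimately have "(m + h) o\<^sub>L m = 0" by (simp add: comp_simps(7))
    then show ?thesis by (simp add: comp_simps add_eq_0_iff2)
  qed
  define k where "k = \<rho> o\<^sub>L m"
  have k: "is_adjoint E k k" unfolding k_def
    by (rule is_adjoint_comp_self[OF norm_pos_selfadjoint[OF \<rho>(1)] m]) (simp add: m\<rho>)
  have am: "a o\<^sub>L m = m o\<^sub>L m"
  proof -
    have "a = 2 *\<^sub>R m + h" by (simp add: m_def)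
    then have "a o\<^sub>L m = 2 *\<^sub>R (m o\<^sub>L m) + (h o\<^sub>L m)" by (simp add: comp_simps)
    then show ?thesis by (simp add: hmm scaleR_2)
  qed
  have kk: "k o\<^sub>L k = m o\<^sub>L (m o\<^sub>L m)"
  proof -
    have "k o\<^sub>L k = \<rho> o\<^sub>L ((m o\<^sub>L \<rho>) o\<^sub>L m)" by (simp add: k_def blinfun_compose_assoc)
    also have "\<dots> = (\<rho> o\<^sub>L \<rho>) o\<^sub>L (m o\<^sub>L m)" by (simp add: m\<rho> blinfun_compose_assoc)
    also have "\<dots> = (a o\<^sub>L m) o\<^sub>L m" by (simp add: \<rho>(2) blinfun_compose_assoc)
    finally show ?thesis by (simp add: am blinfun_compose_assoc)
  qed
  define c c' where "c = T o\<^sub>L m" and "c' = m o\<^sub>L T'"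
  have c: "is_adjoint E c c'" unfolding c_def c'_def by (intro is_adjoint_intros T m)
  have cc: "c' o\<^sub>L c = - (k o\<^sub>L k)"
  proof -
    have "c' o\<^sub>L c = m o\<^sub>L (h o\<^sub>L m)" by (simp add: c_def c'_def h_def blinfun_compose_assoc)
    then show ?thesis by (simp add: hmm kk comp_simps)
  qed
  have "norm_pos (((c' o\<^sub>L c) + (c o\<^sub>L c')) + (k o\<^sub>L k))"
    by (intro norm_pos_add norm_pos_sum_of_products c norm_pos_square k)
  then have "norm_pos (c o\<^sub>L c')" by (simp add: cc)
  then obtain r where r: "norm_pos r" "r o\<^sub>L r = c o\<^sub>L c'" using norm_pos_sqrt by metis
  let ?r2 = "c o\<^sub>L c'" and ?k2 = "k o\<^sub>L k"
  have r2: "is_adjoint E ?r2 ?r2" by (intro is_adjoint_intros c is_adjoint_sym[OF c])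
  have k2: "is_adjoint E ?k2 ?k2" by (intro is_adjoint_intros k)
  define d d' where "d = k o\<^sub>L c'" and "d' = c o\<^sub>L k"
  have d: "is_adjoint E d d'" unfolding d_def d'_def by (intro is_adjoint_intros k is_adjoint_sym[OF c])
  have "d' o\<^sub>L d = c o\<^sub>L (?k2 o\<^sub>L c')" by (simp add: d_def d'_def blinfun_compose_assoc)
  also have "\<dots> = - (c o\<^sub>L ((c' o\<^sub>L c) o\<^sub>L c'))" by (simp add: cc comp_simps)
  finally have d1: "d' o\<^sub>L d = - (?r2 o\<^sub>L ?r2)" by (simp add: blinfun_compose_assoc)
  have "d o\<^sub>L d' = k o\<^sub>L ((c' o\<^sub>L c) o\<^sub>L k)" by (simp add: d_def d'_def blinfun_compose_assoc)
  then have d2: "d o\<^sub>L d' = - (?k2 o\<^sub>L ?k2)" by (simp add: cc comp_simps)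
  have "(?r2 o\<^sub>L ?r2) + (?k2 o\<^sub>L ?k2) = 0"
  proof (rule norm_pos_antisym)
    show "norm_pos ((?r2 o\<^sub>L ?r2) + (?k2 o\<^sub>L ?k2))"
      by (intro norm_pos_add norm_pos_square r2 k2)
    show "norm_pos (- ((?r2 o\<^sub>L ?r2) + (?k2 o\<^sub>L ?k2)))"
      using norm_pos_sum_of_products[OF d] by (simp only: d1 d2 minus_add_distrib)
  qed
  then have "- (?r2 o\<^sub>L ?r2) = ?k2 o\<^sub>L ?k2" by (simp add: eq_neg_iff_add_eq_0 neg_eq_iff_add_eq_0)
  then have "?r2 o\<^sub>L ?r2 = 0"
    using norm_pos_antisym[OF norm_pos_square[OF r2]] norm_pos_square[OF k2] by simp
  then have "?r2 = 0" by (rule selfadjoint_square_zero[OF r2])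
  then have "c' = 0" by (intro comp_adjoint_zero[OF is_adjoint_sym[OF c]])
  then have m3: "m o\<^sub>L (m o\<^sub>L m) = 0" using cc kk by simp
  have mm: "is_adjoint E (m o\<^sub>L m) (m o\<^sub>L m)" by (intro is_adjoint_intros m)
  have "(m o\<^sub>L m) o\<^sub>L (m o\<^sub>L m) = 0" using m3 by (simp add: blinfun_compose_assoc)
  then have "m = 0" using selfadjoint_square_zero[OF mm] selfadjoint_square_zero[OF m] by blast
  then have "h = a" by (simp add: m_def)
  then show ?thesis using a(1) by (simp add: h_def)
qed

end


section \<open>Positive elements of the coefficient algebra\<close>

text \<open>The algebra as a Hilbert module over itself, which makes the results on operators
  available for the left multiplications by its elements.\<close>

definition self_module :: "('b, 'b::z2_graded_cstar_algebra) hmod" where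
  "self_module = \<lparr>act = (*), inn = (\<lambda>x y. star x * y), mgrading = grading\<rparr>"

lemma graded_hilbert_module_self:
  "graded_hilbert_module (self_module :: ('b, 'b::z2_graded_cstar_algebra) hmod)"
proof
  fix x y :: 'b and k b
  show "inn self_module x x = 0 \<Longrightarrow> x = 0"
    using cstar_identity[of x] by (simp add: self_module_def)
qed (auto simp: self_module_def pos_elem_def distrib_left distrib_right mult.assoc
    mult_scaleC_left mult_scaleC_right scaleC_add_right scaleC_add_left star_mult star_star
    cstar_identity grading_add grading_scaleC grading_mult grading_star grading_grading)

interpretation self: graded_hilbert_module self_module
  by (rule graded_hilbert_module_self)

definition left_mult :: "'b \<Rightarrow> 'b \<Rightarrow>\<^sub>L ('b::z2_graded_cstar_algebra)" where
  "left_mult b = Blinfun (\<lambda>x. b * x)"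

lemma left_mult_apply [simp]: "left_mult b x = b * x"
  by (simp add: left_mult_def bounded_linear_Blinfun_apply bounded_linear_mult_right)

lemma left_mult_add: "left_mult (a + b) = left_mult a + left_mult b"
  by (rule blinfun_eqI) (simp add: blinfun.bilinear_simps distrib_right)

lemma left_mult_scaleR: "left_mult (r *\<^sub>R a) = r *\<^sub>R left_mult a"
  by (rule blinfun_eqI) (simp add: blinfun.bilinear_simps)

lemma norm_left_mult [simp]: "norm (left_mult b) = norm b"
proof (rule antisym)
  show "norm (left_mult b) \<le> norm b"
    by (rule norm_blinfun_bound) (auto simp: norm_mult_ineq)
  have "norm b * norm b = norm (left_mult b (star b))"
    using cstar_identity[of "star b"] by (simp add: star_star power2_eq_square)
  also have "\<dots> \<le> norm (left_mult b) * norm b"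
    using norm_blinfun[of "left_mult b" "star b"] by simp
  finally show "norm b \<le> norm (left_mult b)"
    by (cases "b = 0") (auto simp: mult_le_cancel_right)
qed

lemma norm_pos_left_mult:
  assumes "pos_elem b" shows "self.norm_pos (left_mult b)"
proof -
  obtain c where c: "b = star c * c" using assms by (auto simp: pos_elem_def)
  have "is_adjoint self_module (left_mult c) (left_mult (star c))"
    by (simp add: is_adjoint_def self_module_def star_mult mult.assoc)
  moreover have "left_mult (star c) o\<^sub>L left_mult c = left_mult b"
    by (rule blinfun_eqI) (simp add: c mult.assoc)
  ultimately show ?thesis using self.norm_pos_adjoint_comp by metis
qed

text \<open>Monotonicity of the norm is the form in which the order on \<open>B\<close> enters later estimates. The three
  summands are those of \<open>\<langle>p + x, p + x\<rangle>\<close> when \<open>\<langle>p,x\<rangle>\<close> is positive.\<close>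

lemma norm_le_norm_add_pos:
  fixes a b c :: "'b::z2_graded_cstar_algebra"
  assumes "pos_elem a" "pos_elem b" "pos_elem c" "r \<ge> 0"
  shows "norm a \<le> norm (a + (r *\<^sub>R b + c))"
proof -
  have "norm (left_mult a) \<le> norm (left_mult a + (r *\<^sub>R left_mult b + left_mult c))"
    by (intro self.norm_le_of_norm_pos self.norm_pos_add self.norm_pos_scaleR norm_pos_left_mult assms)
  then show ?thesis by (simp flip: left_mult_add left_mult_scaleR)
qed

lemma pos_elem_sum_zero:
  fixes a b :: "'b::z2_graded_cstar_algebra"
  shows "pos_elem a \<Longrightarrow> pos_elem b \<Longrightarrow> a + b = 0 \<Longrightarrow> a = 0"
  using norm_le_norm_add_pos[of a b 0 1] by simp


section \<open>Uniqueness of positive square roots\<close>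

context graded_hilbert_module
begin

lemma positive_total_opD: "positive_op E (total_op R) \<Longrightarrow> pos_elem (inn E (R x) x)"
  by (auto simp: positive_op_def total_op_def dom_def)

lemma positive_total_opI:
  fixes R :: "'e \<Rightarrow>\<^sub>L 'e"
  shows "(\<And>x. pos_elem (inn E (R x) x)) \<Longrightarrow> positive_op E (total_op R)"
  by (auto simp: positive_op_def total_op_def)

text \<open>The form \<open>\<langle>ax,x\<rangle>\<close> of a positive operator detects its kernel, since it is \<open>\<langle>rx,rx\<rangle>\<close> for a root \<open>r\<close>.\<close>

lemma norm_pos_inner:
  assumes "norm_pos a"
  obtains r where "\<And>x. inn E (a x) x = inn E (r x) (r x)" "\<And>x. r x = 0 \<Longrightarrow> a x = 0"
proof -
  obtain r where r: "norm_pos r" "r o\<^sub>L r = a" using norm_pos_sqrt[OF assms] by metis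
  have ra: "a x = r (r x)" for x using r(2) by (metis blinfun_apply_blinfun_compose)
  have "inn E (a x) x = inn E (r x) (r x)" for x
    using norm_pos_selfadjoint[OF r(1)] by (simp add: ra is_adjoint_def)
  then show ?thesis using that[of r] by (simp add: ra)
qed

lemma norm_pos_positive_op: "norm_pos a \<Longrightarrow> positive_op E (total_op a)"
  by (metis norm_pos_inner positive_total_opI inn_pos)

text \<open>The values \<open>\<langle>Rx,x\<rangle>\<close> are self-adjoint, so \<open>\<langle>(R - R\<^sup>*)x,x\<rangle> = 0\<close>, and a sesquilinear form that vanishes
  on the diagonal is zero over the complex numbers.\<close>

lemma positive_op_selfadjoint:
  assumes R: "R \<in> End_adj E" and pos: "positive_op E (total_op R)"
  shows "is_adjoint E R R"
proof -
  obtain R' where R': "is_adjoint E R R'" using R by (auto simp: End_adj_def)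
  define N where "N = R - R'"
  have N: "is_adjoint E N (R' - R)" unfolding N_def by (intro is_adjoint_intros R' is_adjoint_sym[OF R'])
  have "inn E (R x) x = inn E (R' x) x" for x
    using pos_elem_star[OF positive_total_opD[OF pos, of x]] is_adjoint_sym[OF R']
    by (simp add: inn_star is_adjoint_def)
  then have diag: "inn E (N x) x = 0" for x by (simp add: N_def blinfun.bilinear_simps inn_simps)
  have zero: "inn E (N x) y = 0" for x y
  proof -
    have 1: "inn E (N x) y + inn E (N y) x = 0"
      using diag[of "x + y"] diag[of x] diag[of y]
      by (simp add: blinfun.bilinear_simps inn_simps add.commute)
    have "\<i> *\<^sub>C inn E (N x) y - \<i> *\<^sub>C inn E (N y) x = 0"
      using diag[of "x + \<i> *\<^sub>C y"] diag[of x] diag[of y]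
      by (simp add: blinfun.bilinear_simps inn_simps adjointable_scaleC[OF N] scaleC_minus_left)
    then have "\<i> *\<^sub>C (\<i> *\<^sub>C (inn E (N x) y - inn E (N y) x)) = 0"
      by (simp only: scaleC_diff_right[symmetric] scaleC_zero_right)
    then have "inn E (N x) y = inn E (N y) x" by simp
    then have "2 *\<^sub>R inn E (N x) y = 0" using 1 by (simp add: scaleR_2)
    then show ?thesis by simp
  qed
  have "R = R'"
  proof (rule blinfun_eqI)
    fix x show "R x = R' x"
      using inn_definite[OF zero[of x "N x"]] by (simp add: N_def blinfun.bilinear_simps)
  qed
  then show ?thesis using R' by simp
qed

text \<open>The constructed root \<open>r\<close> of \<open>R\<^sup>2\<close> commutes with \<open>R\<close>, so \<open>(r + R)w = 0\<close> for \<open>w = (r - R)z\<close>.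
  Since both \<open>\<langle>rw,w\<rangle>\<close> and \<open>\<langle>Rw,w\<rangle>\<close> are positive, they vanish.\<close>

lemma norm_pos_root_unique:
  assumes R: "is_adjoint E R R" "positive_op E (total_op R)"
    and r: "norm_pos r" "r o\<^sub>L r = R o\<^sub>L R" "\<And>u. u o\<^sub>L (R o\<^sub>L R) = (R o\<^sub>L R) o\<^sub>L u \<Longrightarrow> u o\<^sub>L r = r o\<^sub>L u"
  shows "R = r"
proof (rule blinfun_eqI)
  fix z
  have comm: "R o\<^sub>L r = r o\<^sub>L R" by (rule r(3)) (simp add: blinfun_compose_assoc)
  define w where "w = (r - R) z"
  have "(r + R) o\<^sub>L (r - R) = 0" by (simp add: comp_simps comm r(2))
  moreover have "(r + R) w = ((r + R) o\<^sub>L (r - R)) z" by (simp only: w_def blinfun_apply_blinfun_compose)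
  ultimately have "(r + R) w = 0" by simp
  then have sum: "r w + R w = 0" by (simp add: blinfun.add_left)
  obtain s where s: "\<And>x. inn E (r x) x = inn E (s x) (s x)" "\<And>x. s x = 0 \<Longrightarrow> r x = 0"
    using norm_pos_inner[OF r(1)] by metis
  have "inn E (s w) (s w) + inn E (R w) w = 0"
    unfolding s(1)[symmetric] inn_add_left[symmetric] sum by simp
  then have "inn E (s w) (s w) = 0"
    using pos_elem_sum_zero[OF inn_pos positive_total_opD[OF R(2)]] by blast
  then have "r w = 0" using s(2) inn_definite by blast
  then have Rw: "r w = 0" "R w = 0" using sum by auto
  have "is_adjoint E (r - R) (r - R)" by (intro is_adjoint_intros norm_pos_selfadjoint r R)
  then have "inn E w w = inn E z ((r - R) w)" by (simp add: w_def is_adjoint_def)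
  then have "w = 0" using Rw inn_definite by (simp add: blinfun.bilinear_simps)
  then show "R z = r z" by (simp add: w_def blinfun.bilinear_simps)
qed

lemma positive_sqrt_unique:
  assumes "is_adjoint E R R" "positive_op E (total_op R)"
    and "is_adjoint E Q Q" "positive_op E (total_op Q)" "R o\<^sub>L R = Q o\<^sub>L Q"
  shows "R = Q"
proof -
  obtain r where r: "norm_pos r" "r o\<^sub>L r = R o\<^sub>L R"
      "\<And>u. u o\<^sub>L (R o\<^sub>L R) = (R o\<^sub>L R) o\<^sub>L u \<Longrightarrow> u o\<^sub>L r = r o\<^sub>L u"
    using norm_pos_sqrt[OF norm_pos_square[OF assms(1)]] by metis
  have "R = r" by (rule norm_pos_root_unique[OF assms(1,2) r])
  moreover have "Q = r" by (rule norm_pos_root_unique[OF assms(3,4) r[unfolded assms(5)]])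
  ultimately show ?thesis by simp
qed

lemma sqrt_op_eqI:
  assumes "norm_pos r" shows "sqrt_op E (r o\<^sub>L r) = r"
  unfolding sqrt_op_def
proof (rule the_equality)
  show "r \<in> End_adj E \<and> positive_op E (total_op r) \<and> r o\<^sub>L r = r o\<^sub>L r"
    using assms norm_pos_selfadjoint norm_pos_positive_op by (auto simp: End_adj_def)
  fix R assume "R \<in> End_adj E \<and> positive_op E (total_op R) \<and> R o\<^sub>L R = r o\<^sub>L r"
  then show "R = r"
    using positive_sqrt_unique positive_op_selfadjoint norm_pos_selfadjoint[OF assms]
      norm_pos_positive_op[OF assms] by blast
qed

end


section \<open>Regular self-adjoint operators and their resolvents\<close>

lemma dom_plus_op [simp]: "dom (plus_op D T) = dom D"
  by (auto simp: plus_op_def dom_def)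

lemma the_plus_op [simp]: "x \<in> dom D \<Longrightarrow> the (plus_op D T x) = the (D x) + T x"
  by (auto simp: plus_op_def)

lemma dom_comp_op: "x \<in> dom (A \<circ>\<^sub>m D) \<longleftrightarrow> x \<in> dom D \<and> the (D x) \<in> dom A"
  by (auto simp: map_comp_def dom_def split: option.splits)

lemma the_comp_op [simp]: "x \<in> dom D \<Longrightarrow> the ((A \<circ>\<^sub>m D) x) = the (A (the (D x)))"
  by (auto simp: map_comp_def)

lemma total_op_apply [simp]: "the (total_op T x) = T x" and dom_total_op [simp]: "dom (total_op T) = UNIV"
  by (auto simp: total_op_def)

lemma option_map_eqI:
  assumes "dom f = dom g" "\<And>x. x \<in> dom f \<Longrightarrow> the (f x) = the (g x)" shows "f = g"
proof
  fix x show "f x = g x" using assms(1) assms(2)[of x] by (cases "f x"; cases "g x") auto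
qed

text \<open>Solving \<open>f x + T x = v\<close> is the fixed point problem \<open>x = f\<^sup>-\<^sup>1 (v - T x)\<close> for a contraction. Norm bounds
  make the statement uniform in \<open>f\<close>, so that it can be iterated.\<close>

lemma onto_perturbation:
  fixes f :: "'e::banach \<Rightarrow> 'e"
  assumes M: "\<And>x y. x \<in> M \<Longrightarrow> y \<in> M \<Longrightarrow> x - y \<in> M \<and> f (x - y) = f x - f y"
    and below: "\<And>x. x \<in> M \<Longrightarrow> norm x \<le> norm (f x)"
    and onto: "\<And>v. \<exists>x\<in>M. f x = v"
    and T: "\<And>x. norm (blinfun_apply T x) \<le> norm x / 2"
  shows "\<exists>x\<in>M. f x + T x = v"
proof -
  obtain g where g: "\<And>v. g v \<in> M" "\<And>v. f (g v) = v" using onto by metis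
  have lip: "norm (g v - g w) \<le> norm (v - w)" for v w
    using M[OF g(1) g(1), of v w] below[of "g v - g w"] by (simp add: g(2))
  have "\<exists>!x. g (v - T x) = x"
  proof (rule banach_fix_type[of "1/2"], simp, simp, intro allI)
    fix x y
    have "norm (g (v - T x) - g (v - T y)) \<le> norm ((v - T x) - (v - T y))" by (rule lip)
    also have "\<dots> = norm (T (x - y))" by (simp add: blinfun.diff_right norm_minus_commute)
    also have "\<dots> \<le> 1/2 * norm (x - y)" using T by simp
    finally show "dist (g (v - T x)) (g (v - T y)) \<le> 1/2 * dist x y" by (simp add: dist_norm)
  qed
  then obtain x where "g (v - T x) = x" by blast
  then have "x \<in> M" "f x = v - T x" using g by metis+
  then show ?thesis by (intro bexI[of _ x]) auto
qed

context graded_hilbert_module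
begin

lemma linear_opD:
  assumes "linear_op E D"
  shows "0 \<in> dom D" "x \<in> dom D \<Longrightarrow> y \<in> dom D \<Longrightarrow> x + y \<in> dom D"
    "x \<in> dom D \<Longrightarrow> k *\<^sub>C x \<in> dom D" "x \<in> dom D \<Longrightarrow> act E x b \<in> dom D"
    "x \<in> dom D \<Longrightarrow> y \<in> dom D \<Longrightarrow> the (D (x + y)) = the (D x) + the (D y)"
    "x \<in> dom D \<Longrightarrow> the (D (k *\<^sub>C x)) = k *\<^sub>C the (D x)"
    "x \<in> dom D \<Longrightarrow> the (D (act E x b)) = act E (the (D x)) b"
  using assms unfolding linear_op_def submodule_def by blast+

lemma linear_op_scaleR:
  assumes "linear_op E D" "x \<in> dom D"
  shows "r *\<^sub>R x \<in> dom D" "the (D (r *\<^sub>R x)) = r *\<^sub>R the (D x)"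
  using linear_opD(3,6)[OF assms] by (metis scaleC_of_real)+

lemma linear_op_minus:
  assumes "linear_op E D" "x \<in> dom D"
  shows "- x \<in> dom D" "the (D (- x)) = - the (D x)"
  using linear_op_scaleR[OF assms, of "-1"] by auto

lemma linear_op_diff:
  assumes "linear_op E D" "x \<in> dom D" "y \<in> dom D"
  shows "x - y \<in> dom D" "the (D (x - y)) = the (D x) - the (D y)"
  using linear_opD(2,5)[OF assms(1,2) linear_op_minus(1)[OF assms(1,3)]] linear_op_minus(2)[OF assms(1,3)]
  by auto

definition symmetric_op :: "('e \<rightharpoonup> 'e) \<Rightarrow> bool" where
  "symmetric_op D \<longleftrightarrow> linear_op E D \<and> closure (dom D) = UNIV \<and>
     (\<forall>x\<in>dom D. \<forall>y\<in>dom D. inn E (the (D x)) y = inn E x (the (D y)))"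

lemma symmetric_opD:
  assumes "symmetric_op D"
  shows "linear_op E D" "closure (dom D) = UNIV"
    "x \<in> dom D \<Longrightarrow> y \<in> dom D \<Longrightarrow> inn E (the (D x)) y = inn E x (the (D y))"
  using assms unfolding symmetric_op_def by blast+

lemma norm_le_symmetric_shift:
  assumes D: "symmetric_op D" and x: "x \<in> dom D"
  shows "norm (the (D x)) \<le> norm (the (D x) + \<i> *\<^sub>C (t *\<^sub>R x))"
    and "norm (t *\<^sub>R x) \<le> norm (the (D x) + \<i> *\<^sub>C (t *\<^sub>R x))"
proof -
  have "inn E (the (D x)) (t *\<^sub>R x) = inn E (t *\<^sub>R x) (the (D x))"
    using symmetric_opD(3)[OF D x x] by (simp add: inn_simps)
  then show "norm (the (D x)) \<le> norm (the (D x) + \<i> *\<^sub>C (t *\<^sub>R x))"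
    "norm (t *\<^sub>R x) \<le> norm (the (D x) + \<i> *\<^sub>C (t *\<^sub>R x))"
    using norm_le_norm_add_imul by blast+
qed

text \<open>The real parameter \<open>t\<close> treats \<open>D + i\<close>, \<open>D - i\<close> and \<open>D\<close> itself alike. For a symmetric operator,
  surjectivity at \<open>t = \<plusminus>1\<close> is equivalent to regularity together with self-adjointness. In this form the
  property is easily passed on to perturbations.\<close>

definition shift_onto :: "('e \<rightharpoonup> 'e) \<Rightarrow> real \<Rightarrow> bool" where
  "shift_onto D t \<longleftrightarrow> (\<forall>v. \<exists>x\<in>dom D. the (D x) + \<i> *\<^sub>C (t *\<^sub>R x) = v)"

lemma shift_ontoE:
  assumes "shift_onto D t" obtains x where "x \<in> dom D" "the (D x) + \<i> *\<^sub>C (t *\<^sub>R x) = v"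
  using assms unfolding shift_onto_def by blast

definition resolvent_selfadjoint :: "('e \<rightharpoonup> 'e) \<Rightarrow> bool" where
  "resolvent_selfadjoint D \<longleftrightarrow> symmetric_op D \<and> shift_onto D 1 \<and> shift_onto D (-1)"

lemma shift_diff:
  assumes "linear_op E D" "x \<in> dom D" "y \<in> dom D"
  shows "the (D (x - y)) + \<i> *\<^sub>C (t *\<^sub>R (x - y))
    = (the (D x) + \<i> *\<^sub>C (t *\<^sub>R x)) - (the (D y) + \<i> *\<^sub>C (t *\<^sub>R y))"
  by (simp add: linear_op_diff[OF assms] scaleR_diff_right scaleC_diff_right)

lemma adj_op_eq_Some_iff:
  assumes "closure (dom D) = UNIV"
  shows "adj_op E D y = Some z \<longleftrightarrow> (\<forall>x\<in>dom D. inn E (the (D x)) y = inn E x z)"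
proof -
  define P where "P z \<longleftrightarrow> (\<forall>x\<in>dom D. inn E (the (D x)) y = inn E x z)" for z
  have "z = z'" if "P z" "P z'" for z z'
    by (rule inn_right_eqI_dense[OF assms]) (use that in \<open>simp add: P_def\<close>)
  then have the_eq: "(THE z. P z) = z" if "P z" for z using that by (intro the_equality)
  have "adj_op E D y = (if \<exists>z. P z then Some (THE z. P z) else None)"
    by (simp add: adj_op_def P_def)
  then have "adj_op E D y = Some z \<longleftrightarrow> P z" using the_eq by (auto split: if_splits)
  then show ?thesis by (simp add: P_def)
qed

text \<open>A closed operator that is bounded below has closed range.\<close>

lemma bounded_below_closed_onto:
  assumes D: "symmetric_op D" and cl: "closed (Map.graph D)" and t: "\<bar>t\<bar> = 1"
    and dense: "closure ((\<lambda>x. the (D x) + \<i> *\<^sub>C (t *\<^sub>R x)) ` dom D) = UNIV"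
  shows "shift_onto D t"
  unfolding shift_onto_def
proof
  fix v
  let ?f = "\<lambda>x. the (D x) + \<i> *\<^sub>C (t *\<^sub>R x)"
  have "v \<in> closure (?f ` dom D)" using dense by simp
  then obtain w where w: "\<And>n. w n \<in> ?f ` dom D" "w \<longlonglongrightarrow> v" unfolding closure_sequential by blast
  have "\<forall>n. \<exists>x. x \<in> dom D \<and> w n = ?f x" using w(1) by blast
  from choice[OF this] obtain x where x: "\<And>n. x n \<in> dom D" "\<And>n. w n = ?f (x n)" by blast
  have "norm (x m - x n) \<le> norm (w m - w n)" for m n
    using norm_le_symmetric_shift(2)[OF D linear_op_diff(1)[OF symmetric_opD(1)[OF D] x(1) x(1)], of t m n]
    unfolding shift_diff[OF symmetric_opD(1)[OF D] x(1) x(1)] x(2) by (simp add: t)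
  moreover have "\<exists>N. \<forall>m\<ge>N. \<forall>n\<ge>N. norm (w m - w n) < e" if "e > 0" for e
    using CauchyD[OF LIMSEQ_imp_Cauchy[OF w(2)] that] .
  ultimately have "Cauchy x" by (intro CauchyI) (meson le_less_trans)
  then obtain l where l: "x \<longlonglongrightarrow> l" using Cauchy_convergent convergent_def by blast
  have il: "(\<lambda>n. \<i> *\<^sub>C (t *\<^sub>R x n)) \<longlonglongrightarrow> \<i> *\<^sub>C (t *\<^sub>R l)"
    using blinfun.tendsto[OF tendsto_const tendsto_scaleR[OF tendsto_const l], of imul t] by simp
  have "(\<lambda>n. w n - \<i> *\<^sub>C (t *\<^sub>R x n)) \<longlonglongrightarrow> v - \<i> *\<^sub>C (t *\<^sub>R l)" by (intro tendsto_diff w il)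
  then have "(\<lambda>n. the (D (x n))) \<longlonglongrightarrow> v - \<i> *\<^sub>C (t *\<^sub>R l)" by (simp add: x(2))
  then have "(\<lambda>n. (x n, the (D (x n)))) \<longlonglongrightarrow> (l, v - \<i> *\<^sub>C (t *\<^sub>R l))" by (rule tendsto_Pair[OF l])
  moreover have "(x n, the (D (x n))) \<in> Map.graph D" for n
    using x(1)[of n] by (auto simp: Map.graph_def)
  ultimately have "(l, v - \<i> *\<^sub>C (t *\<^sub>R l)) \<in> Map.graph D"
    by (rule closed_sequentially[OF cl, rotated])
  then have "D l = Some (v - \<i> *\<^sub>C (t *\<^sub>R l))" by (simp add: Map.graph_def)
  then show "\<exists>x\<in>dom D. ?f x = v" by (intro bexI[of _ l]) auto
qed

text \<open>Both \<open>D + i\<close> and \<open>D - i\<close> are left factors of \<open>D\<^sup>2 + 1\<close>, so their ranges are dense with that of the product.\<close>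

lemma regular_selfadjoint_imp_resolvent:
  assumes "regular_selfadjoint E D" shows "resolvent_selfadjoint D"
proof -
  have lin: "linear_op E D" and cl: "closed (Map.graph D)" and dn: "closure (dom D) = UNIV"
    and adj: "adj_op E D = D" and ran: "closure (ran (plus_op (D \<circ>\<^sub>m D) id_blinfun)) = UNIV"
    using assms unfolding regular_selfadjoint_def regular_op_def by auto
  have "inn E (the (D x)) y = inn E x (the (D y))" if "x \<in> dom D" "y \<in> dom D" for x y
  proof -
    have "adj_op E D y = Some (the (D y))" using that unfolding adj by auto
    then show ?thesis using that(1) adj_op_eq_Some_iff[OF dn] by blast
  qed
  then have sym: "symmetric_op D" unfolding symmetric_op_def using lin dn by blast
  have "shift_onto D t" if t: "t = 1 \<or> t = -1" for t
  proof (rule bounded_below_closed_onto[OF sym cl])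
    show "\<bar>t\<bar> = 1" using t by auto
    have "ran (plus_op (D \<circ>\<^sub>m D) id_blinfun) \<subseteq> (\<lambda>x. the (D x) + \<i> *\<^sub>C (t *\<^sub>R x)) ` dom D"
    proof
      fix v assume "v \<in> ran (plus_op (D \<circ>\<^sub>m D) id_blinfun)"
      then obtain x where "plus_op (D \<circ>\<^sub>m D) id_blinfun x = Some v" by (auto simp: ran_def)
      then have x: "x \<in> dom (D \<circ>\<^sub>m D)" "the ((D \<circ>\<^sub>m D) x) + x = v"
        by (auto simp: plus_op_def)
      then have xD: "x \<in> dom D" "the (D x) \<in> dom D" by (auto simp: dom_comp_op)
      define y where "y = the (D x) - \<i> *\<^sub>C (t *\<^sub>R x)"
      have ix: "\<i> *\<^sub>C (t *\<^sub>R x) \<in> dom D" "the (D (\<i> *\<^sub>C (t *\<^sub>R x))) = \<i> *\<^sub>C (t *\<^sub>R the (D x))"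
        using linear_opD(3,6)[OF lin linear_op_scaleR(1)[OF lin xD(1)]] linear_op_scaleR[OF lin xD(1)] by auto
      have y: "y \<in> dom D" "the (D y) = the (D (the (D x))) - \<i> *\<^sub>C (t *\<^sub>R the (D x))"
        unfolding y_def using linear_op_diff[OF lin xD(2) ix(1)] ix(2) by auto
      have "the (D y) + \<i> *\<^sub>C (t *\<^sub>R y) = the (D (the (D x))) + x"
        unfolding y(2) using t by (auto simp: y_def scaleC_diff_right scaleC_minus_right)
      also have "\<dots> = v" using x(2) xD(1) by simp
      finally show "v \<in> (\<lambda>x. the (D x) + \<i> *\<^sub>C (t *\<^sub>R x)) ` dom D" using y(1) by blast
    qed
    then show "closure ((\<lambda>x. the (D x) + \<i> *\<^sub>C (t *\<^sub>R x)) ` dom D) = UNIV"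
      using closure_mono ran by blast
  qed
  then show ?thesis unfolding resolvent_selfadjoint_def using sym by blast
qed

lemma resolvent_selfadjointD:
  assumes "resolvent_selfadjoint D"
  shows "symmetric_op D" "linear_op E D" "\<bar>t\<bar> = 1 \<Longrightarrow> shift_onto D t"
  using assms symmetric_opD(1) unfolding resolvent_selfadjoint_def by (auto simp: abs_if split: if_splits)

text \<open>If \<open>y\<close> is in the domain of the adjoint with value \<open>z\<close>, solve \<open>(D - i)w = z - iy\<close> in the domain of \<open>D\<close>. Then
  \<open>y - w\<close> is orthogonal to the range of \<open>D + i\<close>, hence \<open>y = w\<close>.\<close>

lemma resolvent_imp_adj_op:
  assumes D: "resolvent_selfadjoint D" shows "adj_op E D = D"
proof
  fix y
  note sym = resolvent_selfadjointD(1)[OF D]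
  note dn = symmetric_opD(2)[OF sym]
  have 1: "adj_op E D y = D y" if y: "y \<in> dom D"
    using adj_op_eq_Some_iff[OF dn, of y "the (D y)"] symmetric_opD(3)[OF sym _ y] y by auto
  have 2: "y \<in> dom D" if z: "adj_op E D y = Some z" for z
  proof -
    obtain w where w: "w \<in> dom D" "the (D w) + \<i> *\<^sub>C ((-1) *\<^sub>R w) = z - \<i> *\<^sub>C y"
      using shift_ontoE resolvent_selfadjointD(3)[OF D, of "-1"] by (metis abs_minus_cancel abs_one)
    have eq: "inn E (the (D x) + \<i> *\<^sub>C (1 *\<^sub>R x)) y = inn E (the (D x) + \<i> *\<^sub>C (1 *\<^sub>R x)) w"
      if x: "x \<in> dom D" for x
    proof -
      have "inn E (the (D x)) y = inn E x z" using z x adj_op_eq_Some_iff[OF dn] by blast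
      then have "inn E (the (D x) + \<i> *\<^sub>C (1 *\<^sub>R x)) y = inn E x (the (D w) + \<i> *\<^sub>C ((-1) *\<^sub>R w))"
        unfolding w(2) by (simp add: inn_simps scaleC_minus_left)
      also have "\<dots> = inn E (the (D x) + \<i> *\<^sub>C (1 *\<^sub>R x)) w"
        by (simp add: inn_simps scaleC_minus_left scaleC_minus_right symmetric_opD(3)[OF sym x w(1)])
      finally show ?thesis .
    qed
    have "y = w"
    proof (rule inn_right_eqI)
      fix v
      obtain x where "x \<in> dom D" "the (D x) + \<i> *\<^sub>C (1 *\<^sub>R x) = v"
        using shift_ontoE resolvent_selfadjointD(3)[OF D, of 1] by (metis abs_one)
      then show "inn E v y = inn E v w" using eq by metis
    qed
    then show ?thesis using w by simp
  qed
  show "adj_op E D y = D y"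
    using 1 2 by (cases "adj_op E D y"; cases "D y") auto
qed

lemma resolvent_imp_regular_selfadjoint:
  assumes D: "resolvent_selfadjoint D" shows "regular_selfadjoint E D"
proof -
  note sym = resolvent_selfadjointD(1)[OF D] and lin = resolvent_selfadjointD(2)[OF D]
  note dn = symmetric_opD(2)[OF sym]
  note adj = resolvent_imp_adj_op[OF D]
  have "closed (Map.graph D)"
    unfolding closed_sequential_limits
  proof (intro allI impI, elim conjE)
    fix s l assume s: "\<forall>n. s n \<in> Map.graph D" "s \<longlonglongrightarrow> l"
    have l: "(\<lambda>n. fst (s n)) \<longlonglongrightarrow> fst l" "(\<lambda>n. snd (s n)) \<longlonglongrightarrow> snd l"
      using s(2) by (auto intro: tendsto_intros)
    have sn: "fst (s n) \<in> dom D" "the (D (fst (s n))) = snd (s n)" for n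
      using s(1)[rule_format, of n] by (auto simp: Map.graph_def)
    have "inn E (the (D x)) (fst l) = inn E x (snd l)" if x: "x \<in> dom D" for x
    proof -
      have "(\<lambda>n. inn E (the (D x)) (fst (s n))) \<longlonglongrightarrow> inn E (the (D x)) (fst l)"
        "(\<lambda>n. inn E x (snd (s n))) \<longlonglongrightarrow> inn E x (snd l)"
        by (intro tendsto_inn tendsto_const l)+
      moreover have "inn E (the (D x)) (fst (s n)) = inn E x (snd (s n))" for n
        using symmetric_opD(3)[OF sym x sn(1)] sn(2) by simp
      ultimately show ?thesis using LIMSEQ_unique by simp
    qed
    then have "D (fst l) = Some (snd l)" using adj_op_eq_Some_iff[OF dn, of "fst l" "snd l"] adj by auto
    then show "l \<in> Map.graph D" by (auto simp: Map.graph_def intro: prod_eqI)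
  qed
  moreover have "ran (plus_op (D \<circ>\<^sub>m D) id_blinfun) = UNIV"
  proof (rule UNIV_eq_I[symmetric])
    fix v
    obtain y where y: "y \<in> dom D" "the (D y) + \<i> *\<^sub>C (1 *\<^sub>R y) = v"
      using shift_ontoE resolvent_selfadjointD(3)[OF D, of 1] by (metis abs_one)
    obtain x where x: "x \<in> dom D" "the (D x) + \<i> *\<^sub>C ((-1) *\<^sub>R x) = y"
      using shift_ontoE resolvent_selfadjointD(3)[OF D, of "-1"] by (metis abs_minus_cancel abs_one)
    have Dx: "the (D x) = y + \<i> *\<^sub>C x" using x(2) by (auto simp: scaleC_minus_right)
    have ix: "\<i> *\<^sub>C x \<in> dom D" by (rule linear_opD(3)[OF lin x(1)])
    have "the (D (the (D x))) + x = v"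
      unfolding y(2)[symmetric] Dx linear_opD(5)[OF lin y(1) ix] linear_opD(6)[OF lin x(1)]
      by (simp add: Dx scaleC_add_right)
    moreover have "x \<in> dom (D \<circ>\<^sub>m D)"
      unfolding dom_comp_op Dx using x(1) y(1) ix linear_opD(2)[OF lin] by blast
    ultimately have "plus_op (D \<circ>\<^sub>m D) id_blinfun x = Some v"
      using x(1) by (auto simp: plus_op_def)
    then show "v \<in> ran (plus_op (D \<circ>\<^sub>m D) id_blinfun)" by (auto simp: ran_def)
  qed
  ultimately show ?thesis
    unfolding regular_selfadjoint_def regular_op_def using lin dn adj by simp
qed

lemma symmetric_plus_op:
  assumes D: "symmetric_op D" and T: "is_adjoint E T T" shows "symmetric_op (plus_op D T)"
proof -
  note lin = symmetric_opD(1)[OF D]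
  have "linear_op E (plus_op D T)"
    using lin unfolding linear_op_def dom_plus_op
    by (auto simp: submodule_def blinfun.bilinear_simps scaleC_add_right act_add_left
        adjointable_scaleC[OF T] adjointable_act[OF T])
  then show ?thesis
    using D T unfolding symmetric_op_def by (auto simp: inn_simps is_adjoint_def)
qed

lemma resolvent_plus_small:
  assumes D: "resolvent_selfadjoint D" and T: "is_adjoint E T T" "\<And>x. norm (T x) \<le> norm x / 2"
  shows "resolvent_selfadjoint (plus_op D T)"
proof -
  note sym = resolvent_selfadjointD(1)[OF D] and lin = resolvent_selfadjointD(2)[OF D]
  have "shift_onto (plus_op D T) t" if t: "\<bar>t\<bar> = 1" for t
    unfolding shift_onto_def
  proof
    fix v
    have "\<exists>x\<in>dom D. (the (D x) + \<i> *\<^sub>C (t *\<^sub>R x)) + T x = v"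
    proof (rule onto_perturbation)
      show "x - y \<in> dom D \<and> the (D (x - y)) + \<i> *\<^sub>C (t *\<^sub>R (x - y))
         = (the (D x) + \<i> *\<^sub>C (t *\<^sub>R x)) - (the (D y) + \<i> *\<^sub>C (t *\<^sub>R y))"
        if "x \<in> dom D" "y \<in> dom D" for x y
        using shift_diff[OF lin that] linear_op_diff[OF lin that] by blast
      show "norm x \<le> norm (the (D x) + \<i> *\<^sub>C (t *\<^sub>R x))" if "x \<in> dom D" for x
        using norm_le_symmetric_shift(2)[OF sym that, of t] t by simp
      show "\<exists>x\<in>dom D. the (D x) + \<i> *\<^sub>C (t *\<^sub>R x) = v" for v
        using shift_ontoE[OF resolvent_selfadjointD(3)[OF D t]] by metis
    qed (rule T)
    then show "\<exists>x\<in>dom (plus_op D T). the (plus_op D T x) + \<i> *\<^sub>C (t *\<^sub>R x) = v"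
      by (auto simp: algebra_simps)
  qed
  then show ?thesis
    unfolding resolvent_selfadjoint_def using symmetric_plus_op[OF sym T(1)] by simp
qed

text \<open>A symmetric \<open>D + T/2\<close> has the same lower bound \<open>1\<close> for its shifts by \<open>\<plusminus>i\<close> as \<open>D\<close>. So the second half of \<open>T\<close>
  can be added in the same way as the first.\<close>

lemma resolvent_plus_contraction:
  assumes D: "resolvent_selfadjoint D" and T: "is_adjoint E T T" "\<And>x. norm (T x) \<le> norm x"
  shows "resolvent_selfadjoint (plus_op D T)"
proof -
  let ?H = "(1/2) *\<^sub>R T"
  have H: "is_adjoint E ?H ?H" "norm (?H x) \<le> norm x / 2" for x
    using T by (auto intro: is_adjoint_intros simp: blinfun.bilinear_simps)
  have "plus_op (plus_op D ?H) ?H = plus_op D T"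
  proof (rule option_map_eqI)
    show "the (plus_op (plus_op D ?H) ?H x) = the (plus_op D T x)"
      if "x \<in> dom (plus_op (plus_op D ?H) ?H)" for x
      using that by (simp add: blinfun.bilinear_simps add.assoc flip: scaleR_add_left)
  qed simp
  then show ?thesis using resolvent_plus_small[OF resolvent_plus_small[OF D H] H] by simp
qed

text \<open>For \<open>\<parallel>Dx\<parallel> \<ge> \<parallel>x\<parallel>\<close> all imaginary shifts of \<open>D\<close> are bounded below by \<open>1\<close>, so surjectivity passes
  between \<open>0\<close> and \<open>\<plusminus>i\<close> in two steps of length \<open>1/2\<close>.\<close>

lemma shift_onto_step:
  assumes D: "symmetric_op D" and below: "\<And>x. x \<in> dom D \<Longrightarrow> norm x \<le> norm (the (D x))"
    and t: "shift_onto D t" and s: "\<bar>s\<bar> = 1/2"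
  shows "shift_onto D (t + s)"
  unfolding shift_onto_def
proof
  note lin = symmetric_opD(1)[OF D]
  fix v
  have "\<exists>x\<in>dom D. (the (D x) + \<i> *\<^sub>C (t *\<^sub>R x)) + (s *\<^sub>R imul) x = v"
  proof (rule onto_perturbation)
    show "x - y \<in> dom D \<and> the (D (x - y)) + \<i> *\<^sub>C (t *\<^sub>R (x - y))
       = (the (D x) + \<i> *\<^sub>C (t *\<^sub>R x)) - (the (D y) + \<i> *\<^sub>C (t *\<^sub>R y))"
      if "x \<in> dom D" "y \<in> dom D" for x y
      using shift_diff[OF lin that] linear_op_diff[OF lin that] by blast
    show "norm x \<le> norm (the (D x) + \<i> *\<^sub>C (t *\<^sub>R x))" if "x \<in> dom D" for x
      using norm_le_symmetric_shift(1)[OF D that, of t] below[OF that] by linarith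
    show "\<exists>x\<in>dom D. the (D x) + \<i> *\<^sub>C (t *\<^sub>R x) = v" for v
      using shift_ontoE[OF t] by metis
    show "norm ((s *\<^sub>R imul) x) \<le> norm x / 2" for x
      by (simp add: s blinfun.bilinear_simps norm_scaleC_module)
  qed
  then show "\<exists>x\<in>dom D. the (D x) + \<i> *\<^sub>C ((t + s) *\<^sub>R x) = v"
    by (auto simp: blinfun.bilinear_simps scaleR_add_left scaleC_add_right scaleC_scaleR add.assoc)
qed

lemma resolvent_bounded_below_onto:
  assumes "resolvent_selfadjoint D" and below: "\<And>x. x \<in> dom D \<Longrightarrow> norm x \<le> norm (the (D x))"
  obtains x where "x \<in> dom D" "the (D x) = v"
proof -
  note sym = resolvent_selfadjointD(1)[OF assms(1)]
  note step = shift_onto_step[OF sym below, where s = "-1/2"]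
  have "shift_onto D (1 + (-1/2) + (-1/2))"
    by (intro step resolvent_selfadjointD(3)[OF assms(1)]) auto
  then show ?thesis using shift_ontoE[of D 0 v] that by auto
qed

lemma onto_bounded_below_resolvent:
  assumes D: "symmetric_op D" and below: "\<And>x. x \<in> dom D \<Longrightarrow> norm x \<le> norm (the (D x))"
    and onto: "\<And>v. \<exists>x\<in>dom D. the (D x) = v"
  shows "resolvent_selfadjoint D"
proof -
  note step = shift_onto_step[OF D below]
  have 0: "shift_onto D 0" using onto by (simp add: shift_onto_def)
  have "shift_onto D (0 + s + s)" if "\<bar>s\<bar> = 1/2" for s
    by (intro step 0 that)
  from this[of "1/2"] this[of "-1/2"] show ?thesis
    unfolding resolvent_selfadjoint_def using D by simp
qed

end


section \<open>Resolvents and bounded inverses\<close>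

context graded_hilbert_module
begin

definition is_resolvent :: "('e \<rightharpoonup> 'e) \<Rightarrow> real \<Rightarrow> ('e \<Rightarrow>\<^sub>L 'e) \<Rightarrow> bool" where
  "is_resolvent D t R \<longleftrightarrow> (\<forall>v. R v \<in> dom D \<and> the (D (R v)) + \<i> *\<^sub>C (t *\<^sub>R R v) = v)"

lemma is_resolventD:
  assumes "is_resolvent D t R"
  shows "R v \<in> dom D" "the (D (R v)) + \<i> *\<^sub>C (t *\<^sub>R R v) = v"
  using assms unfolding is_resolvent_def by blast+

lemma resolvent_left_inverse:
  assumes lin: "linear_op E D"
    and below: "\<And>x. x \<in> dom D \<Longrightarrow> norm x \<le> norm (the (D x) + \<i> *\<^sub>C (t *\<^sub>R x))"
    and R: "is_resolvent D t R" and x: "x \<in> dom D"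
  shows "R (the (D x) + \<i> *\<^sub>C (t *\<^sub>R x)) = x"
proof -
  let ?v = "the (D x) + \<i> *\<^sub>C (t *\<^sub>R x)"
  have "norm (R ?v - x) \<le> 0"
    using below[OF linear_op_diff(1)[OF lin is_resolventD(1)[OF R] x], of ?v]
    unfolding shift_diff[OF lin is_resolventD(1)[OF R] x] is_resolventD(2)[OF R] by simp
  then show ?thesis by simp
qed

lemma resolvent_exists:
  assumes lin: "linear_op E D"
    and below: "\<And>x. x \<in> dom D \<Longrightarrow> norm x \<le> norm (the (D x) + \<i> *\<^sub>C (t *\<^sub>R x))"
    and onto: "shift_onto D t"
  obtains R where "is_resolvent D t R"
proof -
  let ?f = "\<lambda>x. the (D x) + \<i> *\<^sub>C (t *\<^sub>R x)"
  have "\<forall>v. \<exists>x. x \<in> dom D \<and> ?f x = v" using onto unfolding shift_onto_def by blast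
  from choice[OF this] obtain g where g: "\<And>v. g v \<in> dom D" "\<And>v. ?f (g v) = v" by blast
  have inj: "x = y" if "x \<in> dom D" "y \<in> dom D" "?f x = ?f y" for x y
    using below[OF linear_op_diff(1)[OF lin that(1,2)]] that(3)
    unfolding shift_diff[OF lin that(1,2)] by simp
  have "bounded_linear g"
  proof (rule bounded_linear_intro[where K=1])
    show "g (v + w) = g v + g w" for v w
    proof (rule inj[OF g(1)])
      show "g v + g w \<in> dom D" by (rule linear_opD(2)[OF lin g(1) g(1)])
      have "?f (g v + g w) = ?f (g v) + ?f (g w)"
        by (simp add: linear_opD(5)[OF lin g(1) g(1)] scaleR_add_right scaleC_add_right)
      then show "?f (g (v + w)) = ?f (g v + g w)" by (simp only: g(2))
    qed
    show "g (r *\<^sub>R v) = r *\<^sub>R g v" for r v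
    proof (rule inj[OF g(1)])
      show "r *\<^sub>R g v \<in> dom D" by (rule linear_op_scaleR(1)[OF lin g(1)])
      have "?f (r *\<^sub>R g v) = r *\<^sub>R ?f (g v)"
        by (simp add: linear_op_scaleR(2)[OF lin g(1)] scaleR_add_right scaleC_scaleR mult.commute)
      then show "?f (g (r *\<^sub>R v)) = ?f (r *\<^sub>R g v)" by (simp only: g(2))
    qed
    show "norm (g v) \<le> norm v * 1" for v
      using below[OF g(1), of v] by (simp only: g(2) mult_1_right)
  qed
  then have "is_resolvent D t (Blinfun g)"
    using g by (simp add: is_resolvent_def bounded_linear_Blinfun_apply)
  then show ?thesis by (rule that)
qed

lemma resolvent_adjoint:
  assumes D: "symmetric_op D" and R: "is_resolvent D t R" "is_resolvent D (- t) R'"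
  shows "is_adjoint E R R'"
  unfolding is_adjoint_def
proof (intro allI)
  fix v w
  note x = is_resolventD[OF R(1), of v] and y = is_resolventD[OF R(2), of w]
  have "inn E (R v) w = inn E (R v) (the (D (R' w)) + \<i> *\<^sub>C ((- t) *\<^sub>R R' w))" by (simp only: y(2))
  also have "\<dots> = inn E (the (D (R v)) + \<i> *\<^sub>C (t *\<^sub>R R v)) (R' w)"
    using symmetric_opD(3)[OF D x(1) y(1)]
    by (simp add: inn_simps scaleC_minus_left scaleC_minus_right)
  also have "\<dots> = inn E v (R' w)" by (simp only: x(2))
  finally show "inn E (R v) w = inn E v (R' w)" .
qed

lemma inverse_op_eqI:
  assumes "is_inverse_op E P R" shows "inverse_op E P = R"
  unfolding inverse_op_def
proof (rule the_equality[where P = "is_inverse_op E P", OF assms])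
  fix R' assume "is_inverse_op E P R'"
  then have "R' x = R x" for x
    using assms unfolding is_inverse_op_def by metis
  then show "R' = R" by (rule blinfun_eqI)
qed

text \<open>\<open>D\<^sup>2 + 1 = (D - it)(D + it)\<close>, as \<open>t\<^sup>2 = 1\<close>. Stating this for both signs shows at once that the two
  resolvents commute.\<close>

lemma resolvent_product_inverse:
  assumes D: "resolvent_selfadjoint D" and t: "\<bar>t\<bar> = 1"
    and R: "is_resolvent D t R" "is_resolvent D (- t) R'"
  shows "is_inverse_op E (plus_op (D \<circ>\<^sub>m D) id_blinfun) (R o\<^sub>L R')"
proof -
  note sym = resolvent_selfadjointD(1)[OF D] and lin = resolvent_selfadjointD(2)[OF D]
  have tt: "t * t = 1" using t abs_mult_self_eq[of t] by simp
  have itit: "\<i> *\<^sub>C (t *\<^sub>R (\<i> *\<^sub>C (t *\<^sub>R z))) = - z" for z :: 'e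
    by (simp add: scaleC_scaleR tt)
  have below: "norm x \<le> norm (the (D x) + \<i> *\<^sub>C (s *\<^sub>R x))" if "x \<in> dom D" "\<bar>s\<bar> = 1" for x s
    using norm_le_symmetric_shift(2)[OF sym that(1), of s] that(2) by simp
  have it: "\<i> *\<^sub>C (t *\<^sub>R x) \<in> dom D" "the (D (\<i> *\<^sub>C (t *\<^sub>R x))) = \<i> *\<^sub>C (t *\<^sub>R the (D x))"
    if "x \<in> dom D" for x
    using linear_opD(3,6)[OF lin linear_op_scaleR(1)[OF lin that]] linear_op_scaleR(2)[OF lin that] by auto
  have adj: "is_adjoint E (R o\<^sub>L R') (R o\<^sub>L R')"
    by (rule is_adjoint_comp[OF _ is_adjoint_sym]; rule resolvent_adjoint[OF sym R])
  have right: "R (R' v) \<in> dom (D \<circ>\<^sub>m D)" "the ((D \<circ>\<^sub>m D) (R (R' v))) + R (R' v) = v" for v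
  proof -
    define w where "w = R' v"
    define x where "x = R w"
    have x: "x \<in> dom D" "the (D x) + \<i> *\<^sub>C (t *\<^sub>R x) = w"
      using is_resolventD[OF R(1), of w] by (simp_all add: x_def)
    have w: "w \<in> dom D" "the (D w) + \<i> *\<^sub>C ((- t) *\<^sub>R w) = v"
      using is_resolventD[OF R(2), of v] by (simp_all add: w_def)
    have Dx: "the (D x) = w - \<i> *\<^sub>C (t *\<^sub>R x)" using x(2) by (simp only: eq_diff_eq)
    have Dw: "the (D w) = v + \<i> *\<^sub>C (t *\<^sub>R w)" using w(2) by (simp add: scaleC_minus_right diff_eq_eq)
    have "the (D (the (D x))) = the (D w) - \<i> *\<^sub>C (t *\<^sub>R the (D x))"
      unfolding Dx linear_op_diff(2)[OF lin w(1) it(1)[OF x(1)]] it(2)[OF x(1)] by simp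
    also have "\<dots> = v + \<i> *\<^sub>C (t *\<^sub>R (\<i> *\<^sub>C (t *\<^sub>R x)))"
      unfolding Dx Dw scaleR_diff_right scaleC_diff_right by simp
    finally have DDx: "the (D (the (D x))) = v - x" unfolding itit by simp
    have "the (D x) \<in> dom D" unfolding Dx by (rule linear_op_diff(1)[OF lin w(1) it(1)[OF x(1)]])
    then have "x \<in> dom (D \<circ>\<^sub>m D)" unfolding dom_comp_op using x(1) by simp
    moreover have "the ((D \<circ>\<^sub>m D) x) + x = v" using x(1) DDx by simp
    ultimately show "R (R' v) \<in> dom (D \<circ>\<^sub>m D)" "the ((D \<circ>\<^sub>m D) (R (R' v))) + R (R' v) = v"
      unfolding x_def w_def .
  qed
  have left: "R (R' (the (D (the (D x))) + x)) = x" if x: "x \<in> dom D" "the (D x) \<in> dom D" for x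
  proof -
    define y where "y = the (D x) + \<i> *\<^sub>C (t *\<^sub>R x)"
    have y: "y \<in> dom D" "the (D y) = the (D (the (D x))) + \<i> *\<^sub>C (t *\<^sub>R the (D x))"
      unfolding y_def using linear_opD(2,5)[OF lin x(2) it(1)[OF x(1)]] it(2)[OF x(1)] by auto
    have "the (D y) + \<i> *\<^sub>C ((- t) *\<^sub>R y) = the (D y) - \<i> *\<^sub>C (t *\<^sub>R y)" by (simp add: scaleC_minus_right)
    also have "\<dots> = the (D (the (D x))) + x"
      unfolding y(2) unfolding y_def scaleR_add_right scaleC_add_right itit by simp
    finally have "R' (the (D (the (D x))) + x) = y"
      using resolvent_left_inverse[OF lin below R(2) y(1)] t by simp
    then show ?thesis using resolvent_left_inverse[OF lin below R(1) x(1)] t by (simp add: y_def)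
  qed
  show ?thesis
    unfolding is_inverse_op_def
  proof (intro conjI allI ballI)
    show "R o\<^sub>L R' \<in> End_adj E" using adj unfolding End_adj_def by blast
    show "(R o\<^sub>L R') v \<in> dom (plus_op (D \<circ>\<^sub>m D) id_blinfun)" for v
      using right(1) by simp
    show "the (plus_op (D \<circ>\<^sub>m D) id_blinfun ((R o\<^sub>L R') v)) = v" for v
      unfolding blinfun_apply_blinfun_compose the_plus_op[OF right(1)] blinfun_apply_id_blinfun
      by (rule right(2))
    show "(R o\<^sub>L R') (the (plus_op (D \<circ>\<^sub>m D) id_blinfun x)) = x"
      if "x \<in> dom (plus_op (D \<circ>\<^sub>m D) id_blinfun)" for x
    proof -
      have x: "x \<in> dom (D \<circ>\<^sub>m D)" "x \<in> dom D" "the (D x) \<in> dom D"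
        using that unfolding dom_plus_op dom_comp_op by blast+
      show ?thesis
        unfolding blinfun_apply_blinfun_compose the_plus_op[OF x(1)] the_comp_op[OF x(2)]
          blinfun_apply_id_blinfun by (rule left[OF x(2,3)])
    qed
  qed
qed


section \<open>The bounded transform\<close>

lemma closure_range_comp:
  fixes A B :: "'e \<Rightarrow>\<^sub>L 'e"
  assumes "closure (range A) = UNIV" "closure (range B) = UNIV"
  shows "closure (range (A o\<^sub>L B)) = UNIV"
proof -
  have "A ` closure (range B) \<subseteq> closure (range (A o\<^sub>L B))"
    by (rule image_closure_subset) (auto intro!: continuous_intros subsetD[OF closure_subset])
  then have "closure (range A) \<subseteq> closure (range (A o\<^sub>L B))"
    using assms(2) closure_minimal[OF _ closed_closure] by metis
  then show ?thesis using assms(1) by blast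
qed

lemma inv_sqrt_one_plus_sq_properties:
  assumes D: "resolvent_selfadjoint D"
    and R: "is_resolvent D 1 R" "is_resolvent D (- 1) R'"
  defines "F \<equiv> inv_sqrt_one_plus_sq E D"
  shows "is_adjoint E F F" "F o\<^sub>L F = R o\<^sub>L R'" "R o\<^sub>L R' = R' o\<^sub>L R"
    "\<And>u. u o\<^sub>L (R o\<^sub>L R') = (R o\<^sub>L R') o\<^sub>L u \<Longrightarrow> u o\<^sub>L F = F o\<^sub>L u"
    "closure (range F) = UNIV"
proof -
  note sym = resolvent_selfadjointD(1)[OF D]
  note inv = inverse_op_eqI[OF resolvent_product_inverse[OF D _ R]]
  have inv': "inverse_op E (plus_op (D \<circ>\<^sub>m D) id_blinfun) = R' o\<^sub>L R"
    by (rule inverse_op_eqI[OF resolvent_product_inverse[OF D, of "-1"]]) (use R in simp_all)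
  show comm: "R o\<^sub>L R' = R' o\<^sub>L R" using inv inv' by simp
  have adj: "is_adjoint E R' R" by (rule is_adjoint_sym[OF resolvent_adjoint[OF sym R]])
  obtain r where r: "norm_pos r" "r o\<^sub>L r = R o\<^sub>L R'"
      "\<And>u. u o\<^sub>L (R o\<^sub>L R') = (R o\<^sub>L R') o\<^sub>L u \<Longrightarrow> u o\<^sub>L r = r o\<^sub>L u"
    using norm_pos_sqrt[OF norm_pos_adjoint_comp[OF adj]] by metis
  have F: "F = r"
    unfolding F_def inv_sqrt_one_plus_sq_def using sqrt_op_eqI[OF r(1)] inv r(2) by simp
  show "is_adjoint E F F" unfolding F by (rule norm_pos_selfadjoint[OF r(1)])
  show FF: "F o\<^sub>L F = R o\<^sub>L R'" unfolding F by (rule r(2))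
  show "u o\<^sub>L F = F o\<^sub>L u" if "u o\<^sub>L (R o\<^sub>L R') = (R o\<^sub>L R') o\<^sub>L u" for u
    unfolding F by (rule r(3)[OF that])
  have ran: "closure (range Q) = UNIV" if Q: "is_resolvent D t Q" and t: "\<bar>t\<bar> = 1" for Q t
  proof -
    have "norm x \<le> norm (the (D x) + \<i> *\<^sub>C (t *\<^sub>R x))" if "x \<in> dom D" for x
      using norm_le_symmetric_shift(2)[OF sym that, of t] t by simp
    then have "dom D \<subseteq> range Q"
      using resolvent_left_inverse[OF resolvent_selfadjointD(2)[OF D] _ Q] by (metis rangeI subsetI)
    then show ?thesis using symmetric_opD(2)[OF sym] closure_mono by blast
  qed
  have "closure (range (F o\<^sub>L F)) = UNIV"
    unfolding FF by (intro closure_range_comp ran[OF R(1)] ran[OF R(2)]) auto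
  moreover have "range (F o\<^sub>L F) \<subseteq> range F" by auto
  ultimately show "closure (range F) = UNIV" using closure_mono by blast
qed

text \<open>An operator dominated by \<open>F\<close> factors through \<open>F\<close>: the map \<open>Fx \<mapsto> Ax\<close> is a contraction on
  the dense range of \<open>F\<close>.\<close>

lemma factor_through_dense_range:
  fixes F A :: "'e \<Rightarrow>\<^sub>L 'e"
  assumes dense: "closure (range F) = UNIV" and le: "\<And>x. norm (A x) \<le> norm (F x)"
  obtains X where "X o\<^sub>L F = A"
proof -
  have "\<exists>w. \<forall>s. (\<lambda>n. F (s n)) \<longlonglongrightarrow> z \<longrightarrow> (\<lambda>n. A (s n)) \<longlonglongrightarrow> w" for z
  proof -
    have "z \<in> closure (range F)" using dense by simp
    then obtain u where u: "\<And>n. u n \<in> range F" "u \<longlonglongrightarrow> z" unfolding closure_sequential by blast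
    have "\<forall>n. \<exists>x. u n = F x" using u(1) by blast
    from choice[OF this] obtain s where s: "\<And>n. u n = F (s n)" by blast
    have le': "norm (A x - A y) \<le> norm (F x - F y)" for x y
      using le[of "x - y"] by (simp add: blinfun.diff_right)
    have "Cauchy (\<lambda>n. A (s n))"
    proof (rule CauchyI)
      fix e :: real assume "e > 0"
      from CauchyD[OF LIMSEQ_imp_Cauchy[OF u(2)] this]
      obtain N where "\<forall>m\<ge>N. \<forall>n\<ge>N. norm (u m - u n) < e" by blast
      then show "\<exists>N. \<forall>m\<ge>N. \<forall>n\<ge>N. norm (A (s m) - A (s n)) < e"
        unfolding s using le' by (meson le_less_trans)
    qed
    then obtain w where w: "(\<lambda>n. A (s n)) \<longlonglongrightarrow> w" using Cauchy_convergent convergent_def by blast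
    have "(\<lambda>n. A (s' n)) \<longlonglongrightarrow> w" if s': "(\<lambda>n. F (s' n)) \<longlonglongrightarrow> z" for s'
    proof -
      have "(\<lambda>n. F (s' n) - F (s n)) \<longlonglongrightarrow> z - z"
        using s' u(2) unfolding s by (intro tendsto_diff) (simp_all add: s)
      then have "(\<lambda>n. F (s' n) - F (s n)) \<longlonglongrightarrow> 0" by simp
      then have "(\<lambda>n. A (s' n) - A (s n)) \<longlonglongrightarrow> 0"
        by (rule Lim_null_comparison[rotated, OF tendsto_norm_zero]) (simp add: le')
      from tendsto_add[OF this w] show ?thesis by simp
    qed
    then show ?thesis by blast
  qed
  then have "\<forall>z. \<exists>w. \<forall>s. (\<lambda>n. F (s n)) \<longlonglongrightarrow> z \<longrightarrow> (\<lambda>n. A (s n)) \<longlonglongrightarrow> w" by blast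
  from choice[OF this] obtain X where X: "\<And>z s. (\<lambda>n. F (s n)) \<longlonglongrightarrow> z \<Longrightarrow> (\<lambda>n. A (s n)) \<longlonglongrightarrow> X z"
    by blast
  have approx: "\<exists>s. (\<lambda>n. F (s n)) \<longlonglongrightarrow> z" for z
  proof -
    have "z \<in> closure (range F)" using dense by simp
    then obtain u where u: "\<And>n. u n \<in> range F" "u \<longlonglongrightarrow> z" unfolding closure_sequential by blast
    have "\<forall>n. \<exists>x. F x = u n" using u(1) by (metis imageE)
    from choice[OF this] obtain s where "\<And>n. F (s n) = u n" by blast
    then show ?thesis using u(2) by (intro exI[of _ s]) simp
  qed
  have "bounded_linear X"
  proof (rule bounded_linear_intro[where K=1])
    fix z z' :: 'e and r :: real
    obtain s s' where s: "(\<lambda>n. F (s n)) \<longlonglongrightarrow> z" "(\<lambda>n. F (s' n)) \<longlonglongrightarrow> z'" using approx by blast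
    have "(\<lambda>n. A (s n + s' n)) \<longlonglongrightarrow> X (z + z')"
      by (rule X) (simp add: blinfun.add_right tendsto_add s)
    moreover have "(\<lambda>n. A (s n + s' n)) \<longlonglongrightarrow> X z + X z'"
      by (simp add: blinfun.add_right tendsto_add X s)
    ultimately show "X (z + z') = X z + X z'" by (rule LIMSEQ_unique)
    have "(\<lambda>n. A (r *\<^sub>R s n)) \<longlonglongrightarrow> X (r *\<^sub>R z)"
      by (rule X) (simp only: blinfun.scaleR_right tendsto_scaleR tendsto_const s)
    moreover have "(\<lambda>n. A (r *\<^sub>R s n)) \<longlonglongrightarrow> r *\<^sub>R X z"
      by (simp only: blinfun.scaleR_right tendsto_scaleR tendsto_const X s)
    ultimately show "X (r *\<^sub>R z) = r *\<^sub>R X z" by (rule LIMSEQ_unique)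
    have "norm (X z) \<le> norm z"
      by (rule LIMSEQ_le[OF tendsto_norm[OF X[OF s(1)]] tendsto_norm[OF s(1)]]) (use le in blast)
    then show "norm (X z) \<le> norm z * 1" by simp
  qed
  then have "Blinfun X o\<^sub>L F = A"
  proof (intro blinfun_eqI)
    fix x
    assume "bounded_linear X"
    moreover have "(\<lambda>n. A x) \<longlonglongrightarrow> X (F x)" by (rule X) (rule tendsto_const)
    then have "X (F x) = A x" by (simp add: LIMSEQ_const_iff)
    ultimately show "(Blinfun X o\<^sub>L F) x = A x" by (simp add: bounded_linear_Blinfun_apply)
  qed
  then show ?thesis by (rule that)
qed

lemma is_adjoint_dense:
  fixes X X' :: "'e \<Rightarrow>\<^sub>L 'e"
  assumes dense: "closure M = UNIV"
    and eq: "\<And>x y. x \<in> M \<Longrightarrow> y \<in> M \<Longrightarrow> inn E (X x) y = inn E x (X' y)"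
  shows "is_adjoint E X X'"
  unfolding is_adjoint_def
proof (intro allI)
  fix x y
  have "x \<in> closure M" "y \<in> closure M" using dense by auto
  then obtain s s' where s: "\<And>n. s n \<in> M" "s \<longlonglongrightarrow> x" "\<And>n. s' n \<in> M" "s' \<longlonglongrightarrow> y"
    unfolding closure_sequential by metis
  have "(\<lambda>n. inn E (X (s n)) (s' n)) \<longlonglongrightarrow> inn E (X x) y"
    "(\<lambda>n. inn E (s n) (X' (s' n))) \<longlonglongrightarrow> inn E x (X' y)"
    by (intro tendsto_inn blinfun.tendsto tendsto_const s)+
  then show "inn E (X x) y = inn E x (X' y)"
    using eq[OF s(1,3)] LIMSEQ_unique by simp
qed

text \<open>The operators \<open>F = (1 + D\<^sup>2)\<^bsup>-1/2\<^esup>\<close> and \<open>R = (D + i)\<^sup>-\<^sup>1\<close> differ by a unitary, namely \<open>V = (D - i)F\<close>. Since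
  \<open>RR\<^sup>* = R\<^sup>*R = F\<^sup>2\<close>, both \<open>Fx \<mapsto> Rx\<close> and \<open>Fx \<mapsto> R\<^sup>*x\<close> are isometric; their extensions are \<open>V\<close> and \<open>V\<^sup>*\<close>.\<close>

lemma resolvent_polar:
  assumes D: "resolvent_selfadjoint D"
    and R: "is_resolvent D 1 R" "is_resolvent D (- 1) R'"
  defines "F \<equiv> inv_sqrt_one_plus_sq E D"
  obtains V V' where "is_adjoint E V V'" "F o\<^sub>L V = R" "R o\<^sub>L V' = F"
proof -
  note F = inv_sqrt_one_plus_sq_properties[OF D R, folded F_def]
  have adj: "is_adjoint E R R'" by (rule resolvent_adjoint[OF resolvent_selfadjointD(1)[OF D] R])
  have FF: "inn E (F x) (F x) = inn E x ((R o\<^sub>L R') x)" for x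
    using F(1) unfolding F(2)[symmetric] by (simp add: is_adjoint_def)
  have "inn E (R x) (R x) = inn E x ((R' o\<^sub>L R) x)" for x
    using adj by (simp add: is_adjoint_def)
  then have nR: "norm (R x) \<le> norm (F x)" for x
    unfolding F(3)[symmetric] using norm_eqI[of "R x" "F x"] FF by simp
  have "inn E (R' x) (R' x) = inn E x ((R o\<^sub>L R') x)" for x
    using is_adjoint_sym[OF adj] by (simp add: is_adjoint_def)
  then have nR': "norm (R' x) \<le> norm (F x)" for x
    using norm_eqI[of "R' x" "F x"] FF by simp
  obtain V where V: "V o\<^sub>L F = R" using factor_through_dense_range[OF F(5) nR] .
  obtain V' where V': "V' o\<^sub>L F = R'" using factor_through_dense_range[OF F(5) nR'] .
  have Vx: "V (F x) = R x" "V' (F x) = R' x" for x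
    using V V' by (metis blinfun_apply_blinfun_compose)+
  have comm: "R' o\<^sub>L F = F o\<^sub>L R'"
    by (rule F(4)) (metis F(3) blinfun_compose_assoc)
  have "is_adjoint E V V'"
  proof (rule is_adjoint_dense[OF F(5)])
    fix a b assume "a \<in> range F" "b \<in> range F"
    then obtain x y where ab: "a = F x" "b = F y" by blast
    have "inn E (R x) (F y) = inn E x ((R' o\<^sub>L F) y)" using adj by (simp add: is_adjoint_def)
    also have "\<dots> = inn E (F x) (R' y)" unfolding comm using F(1) by (simp add: is_adjoint_def)
    finally show "inn E (V a) b = inn E a (V' b)" by (simp add: ab Vx)
  qed
  moreover have FV: "F o\<^sub>L V = R"
    using is_adjoint_comp[OF F(1) \<open>is_adjoint E V V'\<close>] adj V'
    by (metis is_adjoint_sym is_adjoint_unique)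
  moreover have "R o\<^sub>L V' = F"
  proof -
    have eq: "(R o\<^sub>L V') o\<^sub>L F = F o\<^sub>L F" unfolding blinfun_compose_assoc V' F(2) ..
    have "is_adjoint E (R o\<^sub>L V') (V o\<^sub>L R')"
      by (intro is_adjoint_intros adj is_adjoint_sym[OF \<open>is_adjoint E V V'\<close>])
    then have 1: "is_adjoint E (V o\<^sub>L R') (R o\<^sub>L V')" by (rule is_adjoint_sym)
    have "is_adjoint E (V o\<^sub>L R') F"
    proof (rule is_adjoint_sym, rule is_adjoint_dense[OF F(5)])
      fix a b assume "a \<in> range F" "b \<in> range F"
      then obtain x where x: "a = F x" by blast
      have "F a = (R o\<^sub>L V') a" using eq unfolding x by (metis blinfun_apply_blinfun_compose)
      then show "inn E (F a) b = inn E a ((V o\<^sub>L R') b)"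
        using is_adjoint_sym[OF 1] unfolding is_adjoint_def by simp
    qed
    then show ?thesis using 1 is_adjoint_unique by blast
  qed
  ultimately show ?thesis using that by blast
qed

text \<open>For the resolvents \<open>G\<close> and \<open>H\<close> of \<open>D\<close> and \<open>D + T\<close> at \<open>-i\<close> the resolvent identity \<open>H = G(1 - TH)\<close> provides the
  factor; the unitaries above carry it over to the roots. Hence \<open>K(1 + D\<^sup>2)\<^bsup>-1/2\<^esup>\<close> compact implies the same
  for \<open>D + T\<close>.\<close>

lemma inv_sqrt_perturbation_factor:
  assumes D: "resolvent_selfadjoint D" and D': "resolvent_selfadjoint (plus_op D T)"
    and T: "is_adjoint E T T"
  obtains X X' where "is_adjoint E X X'"
    "inv_sqrt_one_plus_sq E (plus_op D T) = inv_sqrt_one_plus_sq E D o\<^sub>L X"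
proof -
  have res: "\<exists>R. is_resolvent C t R" if C: "resolvent_selfadjoint C" and t: "\<bar>t\<bar> = 1" for C t
  proof -
    have "norm x \<le> norm (the (C x) + \<i> *\<^sub>C (t *\<^sub>R x))" if "x \<in> dom C" for x
      using norm_le_symmetric_shift(2)[OF resolvent_selfadjointD(1)[OF C] that, of t] t by simp
    then show ?thesis
      using resolvent_exists[OF resolvent_selfadjointD(2)[OF C] _ resolvent_selfadjointD(3)[OF C t]] by metis
  qed
  obtain G G' where G: "is_resolvent D 1 G" "is_resolvent D (-1) G'"
    using res[OF D, of 1] res[OF D, of "-1"] by auto
  obtain H H' where H: "is_resolvent (plus_op D T) 1 H" "is_resolvent (plus_op D T) (-1) H'"
    using res[OF D', of 1] res[OF D', of "-1"] by auto
  obtain V V' where V: "is_adjoint E V V'" "inv_sqrt_one_plus_sq E D o\<^sub>L V = G"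
    using resolvent_polar[OF D G] by metis
  obtain U U' where U: "is_adjoint E U U'" "H o\<^sub>L U' = inv_sqrt_one_plus_sq E (plus_op D T)"
    using resolvent_polar[OF D' H] by metis
  have H_adj: "is_adjoint E H H'" by (rule resolvent_adjoint[OF resolvent_selfadjointD(1)[OF D'] H])
  have Heq: "H = G o\<^sub>L (id_blinfun - (T o\<^sub>L H))"
  proof (rule blinfun_eqI)
    fix v
    have x: "H v \<in> dom D" using is_resolventD(1)[OF H(1), of v] by simp
    have "the (D (H v)) + \<i> *\<^sub>C (1 *\<^sub>R H v) = v - T (H v)"
      using is_resolventD(2)[OF H(1), of v] x by (simp add: algebra_simps)
    moreover have "norm x \<le> norm (the (D x) + \<i> *\<^sub>C (1 *\<^sub>R x))" if "x \<in> dom D" for x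
      using norm_le_symmetric_shift(2)[OF resolvent_selfadjointD(1)[OF D] that, of 1] by simp
    ultimately have "G (v - T (H v)) = H v"
      using resolvent_left_inverse[OF resolvent_selfadjointD(2)[OF D] _ G(1) x] by metis
    then show "H v = (G o\<^sub>L (id_blinfun - (T o\<^sub>L H))) v" by (simp add: blinfun.bilinear_simps)
  qed
  have "inv_sqrt_one_plus_sq E (plus_op D T) = (G o\<^sub>L (id_blinfun - (T o\<^sub>L H))) o\<^sub>L U'"
    unfolding U(2)[symmetric] using Heq by (rule arg_cong)
  then have "inv_sqrt_one_plus_sq E (plus_op D T)
      = inv_sqrt_one_plus_sq E D o\<^sub>L (V o\<^sub>L ((id_blinfun - (T o\<^sub>L H)) o\<^sub>L U'))"
    unfolding V(2)[symmetric] blinfun_compose_assoc .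
  moreover have "is_adjoint E (V o\<^sub>L ((id_blinfun - (T o\<^sub>L H)) o\<^sub>L U')) ((U o\<^sub>L (id_blinfun - (H' o\<^sub>L T))) o\<^sub>L V')"
    by (intro is_adjoint_intros V U T H_adj is_adjoint_sym[OF U(1)])
  ultimately show ?thesis using that by blast
qed

lemma End_cpt_comp:
  assumes K: "K \<in> End_cpt E" and X: "is_adjoint E X X'" shows "K o\<^sub>L X \<in> End_cpt E"
proof -
  let ?G = "{T. \<exists>x y. \<forall>z. blinfun_apply T z = act E x (inn E y z)}"
  interpret comp: bounded_linear "\<lambda>K. K o\<^sub>L X"
    by (rule bounded_bilinear.bounded_linear_left[OF bounded_bilinear_blinfun_compose])
  have gen: "T o\<^sub>L X \<in> ?G" if T: "T \<in> ?G" for T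
  proof -
    obtain x y where "\<forall>z. T z = act E x (inn E y z)" using T by blast
    then have "\<forall>z. (T o\<^sub>L X) z = act E x (inn E (X' y) z)"
      using is_adjoint_sym[OF X] by (simp add: is_adjoint_def)
    then show ?thesis by blast
  qed
  have "T o\<^sub>L X \<in> span ?G" if "T \<in> span ?G" for T
    using that
  proof (induction rule: span_induct)
    case base
    then show ?case
      by (auto simp: subspace_def comp.add comp.scaleR span_add span_scale span_zero)
  next
    case (step T) then show ?case using gen span_base by blast
  qed
  then have "(\<lambda>K. K o\<^sub>L X) ` closure (span ?G) \<subseteq> closure (span ?G)"
    by (intro image_closure_subset) (auto intro!: comp.continuous_on continuous_on_id subsetD[OF closure_subset])
  then show ?thesis using K unfolding End_cpt_def by blast
qed

end


section \<open>Absolute value and sign\<close>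

context graded_hilbert_module
begin

lemma bounded_inverse_exists:
  assumes Q: "resolvent_selfadjoint Q" and below: "\<And>x. x \<in> dom Q \<Longrightarrow> norm x \<le> norm (the (Q x))"
  obtains R where "is_adjoint E R R" "\<And>z. R z \<in> dom Q" "\<And>z. the (Q (R z)) = z"
    "\<And>x. x \<in> dom Q \<Longrightarrow> R (the (Q x)) = x" "is_inverse_op E Q R"
proof -
  note sym = resolvent_selfadjointD(1)[OF Q] and lin = resolvent_selfadjointD(2)[OF Q]
  have onto: "shift_onto Q 0"
    unfolding shift_onto_def using resolvent_bounded_below_onto[OF Q below] by simp metis
  have below0: "norm x \<le> norm (the (Q x) + \<i> *\<^sub>C (0 *\<^sub>R x))" if "x \<in> dom Q" for x
    using below[OF that] by simp
  obtain R where R: "is_resolvent Q 0 R" using resolvent_exists[OF lin below0 onto] .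
  have "is_adjoint E R R" using resolvent_adjoint[OF sym R, of R] R by simp
  moreover have "R z \<in> dom Q" "the (Q (R z)) = z" for z
    using is_resolventD[OF R, of z] by simp_all
  moreover have "R (the (Q x)) = x" if "x \<in> dom Q" for x
    using resolvent_left_inverse[OF lin below0 R that] by simp
  ultimately show ?thesis using that[of R] unfolding is_inverse_op_def End_adj_def by blast
qed

lemma positive_opD: "positive_op E P \<Longrightarrow> x \<in> dom P \<Longrightarrow> pos_elem (inn E (the (P x)) x)"
  by (simp add: positive_op_def)

lemma pos_elem_swap: "pos_elem (inn E y x) \<Longrightarrow> pos_elem (inn E x y)"
  using pos_elem_star[of "inn E y x"] by (simp add: inn_star)

text \<open>A second positive root \<open>P\<close> of \<open>Q\<^sup>2\<close> is invertible along with its square, the inverse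
  \<open>V = PQ\<^sup>-\<^sup>2\<close> being bounded by \<open>\<parallel>Vz\<parallel> = \<parallel>Q\<^sup>-\<^sup>1z\<parallel>\<close>. So uniqueness of unbounded roots reduces to that of the
  bounded positive root of \<open>Q\<^sup>-\<^sup>2\<close>.\<close>

lemma positive_root_unique_unbounded:
  assumes Q: "resolvent_selfadjoint Q" "positive_op E Q"
    and below: "\<And>x. x \<in> dom Q \<Longrightarrow> norm x \<le> norm (the (Q x))"
    and P: "symmetric_op P" "positive_op E P" and PQ: "P \<circ>\<^sub>m P = Q \<circ>\<^sub>m Q"
  shows "P = Q"
proof -
  note lin = symmetric_opD(1)[OF P(1)]
  obtain R where R: "is_adjoint E R R" "\<And>z. R z \<in> dom Q" "\<And>z. the (Q (R z)) = z"
    "\<And>x. x \<in> dom Q \<Longrightarrow> R (the (Q x)) = x" using bounded_inverse_exists[OF Q(1) below] by metis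
  have domPP: "x \<in> dom P \<and> the (P x) \<in> dom P \<longleftrightarrow> x \<in> dom Q \<and> the (Q x) \<in> dom Q" for x
    using dom_comp_op[of x P P] dom_comp_op[of x Q Q] unfolding PQ by simp
  have PP: "the (P (the (P x))) = the (Q (the (Q x)))" if "x \<in> dom P" "x \<in> dom Q" for x
    using the_comp_op[OF that(1), of P] the_comp_op[OF that(2), of Q] unfolding PQ by simp
  have RRQ: "R (R z) \<in> dom Q" "the (Q (R (R z))) \<in> dom Q" for z
    using R(2,3) by simp_all
  have RRP: "R (R z) \<in> dom P" "the (P (R (R z))) \<in> dom P" for z
    using domPP[of "R (R z)"] RRQ[of z] by auto
  have PPRR: "the (P (the (P (R (R z))))) = z" for z
    using PP[OF RRP(1) RRQ(1)] R(3) by simp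
  have PP_inj: "x = R (R z)" if x: "x \<in> dom P" "the (P x) \<in> dom P" "the (P (the (P x))) = z" for x z
  proof -
    have q: "x \<in> dom Q" "the (Q x) \<in> dom Q" using domPP[of x] x(1,2) by auto
    have "R (R (the (Q (the (Q x))))) = x" using R(4)[OF q(2)] R(4)[OF q(1)] by simp
    then show ?thesis using PP[OF x(1) q(1)] x(3) by simp
  qed
  define v where "v z = the (P (R (R z)))" for z
  have v: "v z \<in> dom P" "the (P (v z)) = z" for z
    unfolding v_def by (rule RRP(2), rule PPRR)
  have "bounded_linear v"
  proof (rule bounded_linear_intro[where K = "norm R"])
    show "v (z + w) = v z + v w" for z w
      unfolding v_def blinfun.add_right by (rule linear_opD(5)[OF lin RRP(1) RRP(1)])
    show "v (r *\<^sub>R z) = r *\<^sub>R v z" for r z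
      unfolding v_def blinfun.scaleR_right by (rule linear_op_scaleR(2)[OF lin RRP(1)])
    show "norm (v z) \<le> norm z * norm R" for z
    proof -
      have "inn E (v z) (v z) = inn E (R (R z)) (the (P (v z)))"
        unfolding v_def by (rule symmetric_opD(3)[OF P(1) RRP])
      also have "\<dots> = inn E (R z) (R z)"
        using R(1) by (simp add: v(2) is_adjoint_def)
      finally have "norm (v z) = norm (R z)" by (rule norm_eqI)
      then show ?thesis using norm_blinfun[of R z] by (simp add: mult.commute)
    qed
  qed
  from bounded_linear_Blinfun_apply[OF this]
  obtain V where V: "\<And>z. blinfun_apply V z = v z" by metis
  have V_adj: "is_adjoint E V V"
    unfolding is_adjoint_def V
  proof (intro allI)
    fix x y show "inn E (v x) y = inn E x (v y)"
      using symmetric_opD(3)[OF P(1) v(1) v(1), of x y] by (simp only: v(2))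
  qed
  have "V = R"
  proof (rule positive_sqrt_unique[OF V_adj _ R(1)])
    show "positive_op E (total_op V)"
    proof (rule positive_total_opI)
      show "pos_elem (inn E (V z) z)" for z
        using pos_elem_swap[OF positive_opD[OF P(2) v(1), of z]] by (simp add: V v(2))
    qed
    show "positive_op E (total_op R)"
    proof (rule positive_total_opI)
      show "pos_elem (inn E (R z) z)" for z
        using pos_elem_swap[OF positive_opD[OF Q(2) R(2), of z]] by (simp add: R(3))
    qed
    show "V o\<^sub>L V = R o\<^sub>L R"
    proof (rule blinfun_eqI)
      fix z
      have "v (v z) = R (R z)" by (rule PP_inj) (simp_all add: v)
      then show "(V o\<^sub>L V) z = (R o\<^sub>L R) z" by (simp add: V)
    qed
  qed
  then have RV: "R z = v z" for z using V by simp
  have vP: "v (the (P x)) = x" if x: "x \<in> dom P" for x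
  proof -
    define w where "w = x - v (the (P x))"
    have w: "w \<in> dom P" "the (P w) = 0"
      unfolding w_def using linear_op_diff[OF lin x v(1)] v(2) by simp_all
    have P0: "0 \<in> dom P" "the (P 0) = 0"
      using linear_opD(1)[OF lin] linear_op_scaleR(2)[OF lin linear_opD(1)[OF lin], of 0] by simp_all
    have "w = R (R 0)" by (rule PP_inj) (simp_all add: w P0)
    then show ?thesis by (simp add: w_def blinfun.zero_right)
  qed
  show "P = Q"
  proof (rule option_map_eqI)
    show "dom P = dom Q"
    proof (intro equalityI subsetI)
      show "x \<in> dom Q" if "x \<in> dom P" for x using R(2)[of "the (P x)"] vP[OF that] by (simp add: RV)
      show "x \<in> dom P" if "x \<in> dom Q" for x using v(1)[of "the (Q x)"] R(4)[OF that] by (simp add: RV)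
    qed
    show "the (P x) = the (Q x)" if "x \<in> dom P" for x
      using R(3)[of "the (P x)"] vP[OF that] by (simp add: RV)
  qed
qed

lemma abs_op_eqI:
  assumes Q: "resolvent_selfadjoint Q" "positive_op E Q"
    and below: "\<And>x. x \<in> dom Q \<Longrightarrow> norm x \<le> norm (the (Q x))"
    and QD: "Q \<circ>\<^sub>m Q = D \<circ>\<^sub>m D"
  shows "abs_op E D = Q"
  unfolding abs_op_def
proof (rule the_equality)
  show "regular_selfadjoint E Q \<and> positive_op E Q \<and> Q \<circ>\<^sub>m Q = D \<circ>\<^sub>m D"
    by (intro conjI resolvent_imp_regular_selfadjoint Q QD)
  fix P assume P: "regular_selfadjoint E P \<and> positive_op E P \<and> P \<circ>\<^sub>m P = D \<circ>\<^sub>m D"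
  then have P': "symmetric_op P" "positive_op E P" "P \<circ>\<^sub>m P = Q \<circ>\<^sub>m Q"
    unfolding QD by (auto intro: resolvent_selfadjointD(1)[OF regular_selfadjoint_imp_resolvent])
  show "P = Q" by (rule positive_root_unique_unbounded[OF Q below P'])
qed

lemma sgn_op_eqI:
  fixes U :: "'e \<Rightarrow>\<^sub>L 'e"
  assumes R: "is_inverse_op E (abs_op E D) R"
    and ran: "\<And>z. R z \<in> dom D" and U: "\<And>z. the (D (R z)) = U z"
  shows "sgn_op E D = U"
proof -
  have eq: "D \<circ>\<^sub>m total_op (inverse_op E (abs_op E D)) = total_op U"
  proof
    fix z
    obtain y where "D (R z) = Some y" using ran[of z] by blast
    then show "(D \<circ>\<^sub>m total_op (inverse_op E (abs_op E D))) z = total_op U z"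
      using U[of z] by (simp add: inverse_op_eqI[OF R] total_op_def)
  qed
  show ?thesis
    unfolding sgn_op_def eq
  proof (rule the_equality)
    show "total_op U = total_op U" by (rule refl)
    fix U' :: "'e \<Rightarrow>\<^sub>L 'e" assume eq: "total_op U' = total_op U"
    have "U' z = U z" for z using fun_cong[OF eq, of z] by (simp add: total_op_def)
    then show "U' = U" by (rule blinfun_eqI)
  qed
qed

lemma norm_add_pos:
  assumes "pos_elem (inn E p x)"
  shows "norm x \<le> norm (p + x)" "norm p \<le> norm (p + x)"
proof -
  have "inn E x p = inn E p x" using pos_elem_star[OF assms] by (simp add: inn_star)
  then have sum: "inn E (p + x) (p + x) = inn E x x + (2 *\<^sub>R inn E p x + inn E p p)"
    by (simp add: inn_simps scaleR_2)
  then have sum': "inn E (p + x) (p + x) = inn E p p + (2 *\<^sub>R inn E p x + inn E x x)" by simp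
  have "(norm x)\<^sup>2 \<le> (norm (p + x))\<^sup>2"
    unfolding norm_sq sum by (rule norm_le_norm_add_pos[OF inn_pos assms inn_pos]) simp
  moreover have "(norm p)\<^sup>2 \<le> (norm (p + x))\<^sup>2"
    unfolding norm_sq sum' by (rule norm_le_norm_add_pos[OF inn_pos assms inn_pos]) simp
  ultimately show "norm x \<le> norm (p + x)" "norm p \<le> norm (p + x)"
    by (auto intro: power2_le_imp_le)
qed

text \<open>That \<open>Q = P + 1\<close> is positive amounts to positivity of \<open>\<langle>Px,x\<rangle> + \<langle>x,x\<rangle>\<close> in \<open>B\<close>. It is read off from the root
  of \<open>Q\<^sup>-\<^sup>1\<close>, which exists as \<open>\<parallel>z - Q\<^sup>-\<^sup>1z\<parallel> = \<parallel>Px\<parallel> \<le> \<parallel>Qx\<parallel> = \<parallel>z\<parallel>\<close> for \<open>x = Q\<^sup>-\<^sup>1z\<close>.\<close>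

lemma positive_op_one_plus:
  assumes Q: "resolvent_selfadjoint Q"
    and pos: "\<And>x. x \<in> dom Q \<Longrightarrow> pos_elem (inn E (the (Q x) - x) x)"
  shows "positive_op E Q"
proof -
  have nrm: "norm x \<le> norm (the (Q x))" "norm (the (Q x) - x) \<le> norm (the (Q x))" if "x \<in> dom Q" for x
    using norm_add_pos[OF pos[OF that]] by simp_all
  obtain R where R: "is_adjoint E R R" "\<And>z. R z \<in> dom Q" "\<And>z. the (Q (R z)) = z"
    "\<And>x. x \<in> dom Q \<Longrightarrow> R (the (Q x)) = x" using bounded_inverse_exists[OF Q nrm(1)] by metis
  have "norm (id_blinfun - R) \<le> 1"
  proof (rule norm_blinfun_bound)
    show "norm ((id_blinfun - R) z) \<le> 1 * norm z" for z
      using nrm(2)[OF R(2), of z] by (simp add: R(3) blinfun.bilinear_simps)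
  qed simp
  then have "norm_pos R" using R(1) unfolding norm_pos_def by (auto intro!: exI[of _ 1])
  then have "positive_op E (total_op R)" by (rule norm_pos_positive_op)
  then have "pos_elem (inn E (R z) z)" for z by (rule positive_total_opD)
  then show ?thesis
    unfolding positive_op_def using R(4) pos_elem_swap by metis
qed


section \<open>Graded commutators with a perturbed operator\<close>

lemma mgrading_scaleR: "mgrading E (r *\<^sub>R x) = r *\<^sub>R mgrading E x"
  by (metis mgrading_scaleC scaleC_of_real)

lemma hcomp_dom:
  assumes lin: "linear_op E D" and odd: "odd_op E D" and T: "\<And>x. x \<in> dom D \<Longrightarrow> T x \<in> dom D"
    and x: "x \<in> dom D"
  shows "hcomp E j T x \<in> dom D"
  unfolding hcomp_def using odd T x
  by (intro linear_op_scaleR(1)[OF lin] linear_opD(2)[OF lin]) (auto simp: odd_op_def)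

lemma hcomp_add_right:
  "hcomp E j (blinfun_apply w) (x + y) = hcomp E j (blinfun_apply w) x + hcomp E j (blinfun_apply w) y"
  by (simp add: hcomp_def blinfun.add_right mgrading_add scaleR_add_right)

lemma hcomp_plus_op:
  assumes odd: "odd_op E D" and x: "x \<in> dom D"
  shows "hcomp E i (\<lambda>x. the (plus_op D S x)) x = hcomp E i (\<lambda>x. the (D x)) x + hcomp E i (blinfun_apply S) x"
proof -
  have "mgrading E x \<in> dom D" using odd x by (auto simp: odd_op_def)
  then show ?thesis using x by (simp add: hcomp_def mgrading_add scaleR_add_right)
qed

lemma gcomm_plus_op:
  assumes lin: "linear_op E D" and odd: "odd_op E D"
    and w: "\<And>x. x \<in> dom D \<Longrightarrow> blinfun_apply w x \<in> dom D" and x: "x \<in> dom D"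
  shows "gcomm E (\<lambda>x. the (plus_op D S x)) w x = gcomm E (\<lambda>x. the (D x)) w x + gcomm E S w x"
proof -
  have y: "hcomp E j w x \<in> dom D" for j by (rule hcomp_dom[OF lin odd w x])
  have "hcomp E i (\<lambda>x. the (plus_op D S x)) (hcomp E j w x) - r *\<^sub>R hcomp E j w (hcomp E i (\<lambda>x. the (plus_op D S x)) x)
    = (hcomp E i (\<lambda>x. the (D x)) (hcomp E j w x) - r *\<^sub>R hcomp E j w (hcomp E i (\<lambda>x. the (D x)) x))
      + (hcomp E i S (hcomp E j w x) - r *\<^sub>R hcomp E j w (hcomp E i S x))" for i j :: nat and r :: real
    unfolding hcomp_plus_op[OF odd y] hcomp_plus_op[OF odd x] hcomp_add_right
    by (simp add: scaleR_add_right)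
  then show ?thesis unfolding gcomm_def by (simp only: sum.distrib)
qed

text \<open>The commutator with \<open>D + S\<close> is the one with \<open>D\<close>, since \<open>w\<close> commutes with \<open>S\<close>. Compactness is
  inherited through the adjointable factor between the two bounded transforms.\<close>

lemma Lip0_plus_op:
  assumes D: "resolvent_selfadjoint D" "odd_op E D" and D': "resolvent_selfadjoint (plus_op D S)"
    and S: "is_adjoint E S S" and w: "w \<in> Lip0 E D" "\<And>x. gcomm E S w x = 0"
  shows "w \<in> Lip0 E (plus_op D S)"
proof -
  have Lip: "w \<in> End_adj E" "\<And>x. x \<in> dom D \<Longrightarrow> w x \<in> dom D"
    "\<exists>C\<in>End_adj E. \<forall>x\<in>dom D. C x = gcomm E (\<lambda>x. the (D x)) w x"
    using w(1) unfolding Lip0_def Lip_def by auto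
  have "w \<in> Lip E (plus_op D S)"
    unfolding Lip_def using Lip
    by (simp add: gcomm_plus_op[OF resolvent_selfadjointD(2)[OF D(1)] D(2) Lip(2)] w(2))
  moreover obtain X X' where X: "is_adjoint E X X'"
    "inv_sqrt_one_plus_sq E (plus_op D S) = inv_sqrt_one_plus_sq E D o\<^sub>L X"
    using inv_sqrt_perturbation_factor[OF D(1) D' S] .
  moreover have "w o\<^sub>L inv_sqrt_one_plus_sq E D \<in> End_cpt E" "adj E w o\<^sub>L inv_sqrt_one_plus_sq E D \<in> End_cpt E"
    using w(1) unfolding Lip0_def by auto
  ultimately show ?thesis
    unfolding Lip0_def using End_cpt_comp[OF _ X(1)] by (simp flip: blinfun_compose_assoc)
qed


section \<open>Adding the spectral symmetry\<close>

text \<open>The candidate for \<open>|D + S|\<close> is \<open>Q = S(D + S) = SD + 1\<close>. It is a positive root of \<open>(D + S)\<^sup>2\<close>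
  because \<open>S\<close> commutes with \<open>D + S\<close> and \<open>S\<^sup>2 = 1\<close>.\<close>

lemma spectral_symmetry_perturbation:
  assumes D: "resolvent_selfadjoint D" and S: "is_adjoint E S S" "S o\<^sub>L S = id_blinfun"
    and dom: "\<And>x. x \<in> dom D \<Longrightarrow> S x \<in> dom D"
    and comm: "\<And>x. x \<in> dom D \<Longrightarrow> the (D (S x)) = S (the (D x))"
    and pos: "positive_op E (total_op S \<circ>\<^sub>m D)"
  shows "resolvent_selfadjoint (plus_op D S)" "invertible_op E (plus_op D S)"
    "sgn_op E (plus_op D S) = S"
proof -
  let ?D = "plus_op D S"
  define Q where "Q = total_op S \<circ>\<^sub>m ?D"
  note sym = resolvent_selfadjointD(1)[OF D] and lin = resolvent_selfadjointD(2)[OF D]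
  have SS [simp]: "S (S x) = x" for x
    using S(2) by (metis blinfun_apply_blinfun_compose blinfun_apply_id_blinfun)
  have norm_S [simp]: "norm (S x) = norm x" for x
    by (rule norm_eqI) (use S(1) in \<open>simp add: is_adjoint_def\<close>)
  show D': "resolvent_selfadjoint ?D"
    by (rule resolvent_plus_contraction[OF D S(1)]) simp
  note sym' = resolvent_selfadjointD(1)[OF D'] and lin' = resolvent_selfadjointD(2)[OF D']
  have domQ: "x \<in> dom Q \<longleftrightarrow> x \<in> dom D" for x
    unfolding Q_def dom_comp_op by simp
  have Qx: "the (Q x) = S (the (D x)) + x" if "x \<in> dom D" for x
    using that by (simp add: Q_def blinfun.add_right)
  have QS: "the (Q x) = S (the (?D x))" if "x \<in> dom D" for x
    using that by (simp add: Q_def)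
  have SQ: "the (?D x) = S (the (Q x))" if "x \<in> dom D" for x
    using QS[OF that] by simp
  have D'S: "the (?D (S x)) = S (the (?D x))" if "x \<in> dom D" for x
    using that dom comm by (simp add: blinfun.add_right)
  have pos_x: "pos_elem (inn E (the (Q x) - x) x)" if "x \<in> dom D" for x
  proof -
    have "x \<in> dom (total_op S \<circ>\<^sub>m D)" unfolding dom_comp_op using that by simp
    from positive_opD[OF pos this] show ?thesis using that by (simp add: Qx)
  qed
  have belowQ: "norm x \<le> norm (the (Q x))" if "x \<in> dom Q" for x
    using norm_add_pos(1)[OF pos_x] that domQ by simp
  have belowD': "norm x \<le> norm (the (?D x))" if "x \<in> dom ?D" for x
    using belowQ[of x] that domQ[of x] SQ[of x] by simp
  obtain R :: "'e \<Rightarrow>\<^sub>L 'e" where R: "\<And>z. R z \<in> dom ?D" "\<And>z. the (?D (R z)) = z" "is_inverse_op E ?D R"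
    using bounded_inverse_exists[OF D' belowD'] by metis
  then show "invertible_op E ?D" unfolding invertible_op_def by blast
  have "linear_op E Q"
    unfolding linear_op_def
  proof (intro conjI ballI allI)
    have "dom Q = dom D" using domQ by blast
    then show "submodule E (dom Q)" using lin unfolding linear_op_def by simp
    show "the (Q (x + y)) = the (Q x) + the (Q y)" if "x \<in> dom Q" "y \<in> dom Q" for x y
      using that linear_opD(2,5)[OF lin] by (simp add: domQ Qx blinfun.add_right)
    show "the (Q (k *\<^sub>C x)) = k *\<^sub>C the (Q x)" if "x \<in> dom Q" for k x
      using that linear_opD(3,6)[OF lin] by (simp add: domQ Qx adjointable_scaleC[OF S(1)] scaleC_add_right)
    show "the (Q (act E x b)) = act E (the (Q x)) b" if "x \<in> dom Q" for b x
      using that linear_opD(4,7)[OF lin] by (simp add: domQ Qx adjointable_act[OF S(1)] act_add_left)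
  qed
  moreover have "closure (dom Q) = UNIV"
    using symmetric_opD(2)[OF sym] domQ by (metis subset_antisym subsetI)
  moreover have "inn E (the (Q x)) y = inn E x (the (Q y))" if "x \<in> dom Q" "y \<in> dom Q" for x y
  proof -
    have xy: "x \<in> dom D" "y \<in> dom D" using that domQ by auto
    have "inn E (S (the (D x))) y = inn E (the (D x)) (S y)" using S(1) by (simp add: is_adjoint_def)
    also have "\<dots> = inn E x (S (the (D y)))"
      using symmetric_opD(3)[OF sym xy(1) dom[OF xy(2)]] comm[OF xy(2)] by simp
    finally show ?thesis using xy by (simp add: Qx inn_simps)
  qed
  ultimately have symQ: "symmetric_op Q" unfolding symmetric_op_def by blast
  have ontoQ: "\<exists>x\<in>dom Q. the (Q x) = v" for v
    using R(1)[of "S v"] R(2)[of "S v"] QS[of "R (S v)"] domQ by (intro bexI[of _ "R (S v)"]) auto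
  have Q: "resolvent_selfadjoint Q" by (rule onto_bounded_below_resolvent[OF symQ belowQ ontoQ])
  have posQ: "positive_op E Q" by (rule positive_op_one_plus[OF Q]) (simp add: domQ pos_x)
  have QQ: "Q \<circ>\<^sub>m Q = ?D \<circ>\<^sub>m ?D"
  proof (rule option_map_eqI)
    have iff: "the (Q x) \<in> dom D \<longleftrightarrow> the (?D x) \<in> dom D" if "x \<in> dom D" for x
      using dom[of "the (Q x)"] dom[of "the (?D x)"] QS[OF that] SQ[OF that] by metis
    have "x \<in> dom (Q \<circ>\<^sub>m Q) \<longleftrightarrow> x \<in> dom (?D \<circ>\<^sub>m ?D)" for x
      unfolding dom_comp_op domQ dom_plus_op using iff by blast
    then show "dom (Q \<circ>\<^sub>m Q) = dom (?D \<circ>\<^sub>m ?D)" by blast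
    fix x assume "x \<in> dom (Q \<circ>\<^sub>m Q)"
    then have x: "x \<in> dom D" "the (Q x) \<in> dom D" "the (?D x) \<in> dom D"
      unfolding dom_comp_op domQ using iff by auto
    have "the (Q (the (Q x))) = S (the (?D (S (the (?D x)))))"
      unfolding QS[OF x(2)] unfolding QS[OF x(1)] ..
    also have "\<dots> = the (?D (the (?D x)))" unfolding D'S[OF x(3)] SS ..
    finally show "the ((Q \<circ>\<^sub>m Q) x) = the ((?D \<circ>\<^sub>m ?D) x)"
      using x(1) by (simp only: the_comp_op domQ dom_plus_op)
  qed
  have abs: "abs_op E ?D = Q" by (rule abs_op_eqI[OF Q posQ belowQ QQ])
  obtain K :: "'e \<Rightarrow>\<^sub>L 'e" where K: "\<And>z. K z \<in> dom Q" "\<And>z. the (Q (K z)) = z" "is_inverse_op E Q K"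
    using bounded_inverse_exists[OF Q belowQ] by metis
  show "sgn_op E ?D = S"
  proof (rule sgn_op_eqI)
    show "is_inverse_op E (abs_op E ?D) K" unfolding abs by (rule K(3))
    show "K z \<in> dom ?D" for z using K(1) domQ by simp
    show "the (?D (K z)) = S z" for z using SQ[of "K z"] K(1,2) domQ by simp
  qed
qed

lemma odd_plus_op:
  assumes "odd_op E D" "odd_op E (total_op S)" shows "odd_op E (plus_op D S)"
  using assms by (simp add: odd_op_def mgrading_add)

end

theorem proposition4p8:
  fixes \<pi> :: "'a::z2_graded_cstar_algebra \<Rightarrow> ('e::{complex_vector, banach} \<Rightarrow>\<^sub>L 'e)"
    and E :: "('e, 'b::z2_graded_cstar_algebra) hmod"
    and D :: "'e \<rightharpoonup> 'e"
    and S :: "'e \<Rightarrow>\<^sub>L 'e"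
  assumes "sigma_unital TYPE('a)" and "sigma_unital TYPE('b)"
    and "unbounded_cycle \<pi> E D"
    and "spectral_symmetry \<pi> E D S"
  shows "unbounded_cycle \<pi> E (plus_op D S) \<and> spectrally_degenerate \<pi> E (plus_op D S)"
proof -
  interpret graded_hilbert_module E
    using assms(3) by (simp add: unbounded_cycle_def)
  have cycle: "countably_generated E" "graded_star_hom E \<pi>" "regular_selfadjoint E D" "odd_op E D"
    using assms(3) by (auto simp: unbounded_cycle_def)
  have S: "S \<in> End_adj E" "odd_op E (total_op S)" "adj E S = S" "adj E S o\<^sub>L S = id_blinfun"
    "\<And>x. x \<in> dom D \<Longrightarrow> S x \<in> dom D" "\<And>x. x \<in> dom D \<Longrightarrow> the (D (S x)) - S (the (D x)) = 0"
    "positive_op E (total_op S \<circ>\<^sub>m D)"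
    using assms(4) unfolding spectral_symmetry_def by blast+
  obtain W where W: "W \<subseteq> Lip0 E D" "range \<pi> \<subseteq> closure W" "\<And>w x. w \<in> W \<Longrightarrow> gcomm E S w x = 0"
  proof -
    have "\<exists>W\<subseteq>Lip0 E D. range \<pi> \<subseteq> closure W \<and> (\<forall>w\<in>W. \<forall>x. gcomm E S w x = 0)"
      using assms(4) unfolding spectral_symmetry_def by (elim conjE)
    then show ?thesis by (elim exE conjE) (rule that, auto)
  qed
  obtain S' where S': "is_adjoint E S S'" using S(1) by (auto simp: End_adj_def)
  then have S_adj: "is_adjoint E S S" using adj_eqI[OF S'] S(3) by simp
  have SS: "S o\<^sub>L S = id_blinfun" using S(3,4) by simp
  note D = regular_selfadjoint_imp_resolvent[OF cycle(3)]
  have comm: "the (D (S x)) = S (the (D x))" if "x \<in> dom D" for x using S(6)[OF that] by simp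
  have D': "resolvent_selfadjoint (plus_op D S)" "invertible_op E (plus_op D S)"
    "sgn_op E (plus_op D S) = S"
    using spectral_symmetry_perturbation[OF D S_adj SS S(5) comm S(7)] by simp_all
  have WL: "W \<subseteq> Lip0 E (plus_op D S)"
    by (intro subsetI Lip0_plus_op[OF D cycle(4) D'(1) S_adj] W(3) subsetD[OF W(1)])
  have "range \<pi> \<subseteq> closure (Lip0 E (plus_op D S))"
    using W(2) closure_mono[OF WL] by blast
  then have "unbounded_cycle \<pi> E (plus_op D S)"
    unfolding unbounded_cycle_def
    by (intro conjI graded_hilbert_module_axioms cycle resolvent_imp_regular_selfadjoint[OF D'(1)]
        odd_plus_op S(2))
  moreover have "spectrally_degenerate \<pi> E (plus_op D S)"
    unfolding spectrally_degenerate_def D'(3) by (intro conjI D'(2) exI[of _ W] WL W(2)) (simp add: W(3))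
  ultimately show ?thesis by blast
qed


end
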